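(* For an open domain $\Omega\subset\mathbb{R}^{n+1}$, the transverse operators associating with $F\in\mathscr U(\Omega)$ the vector fields $$\mathsf W(F)^i=-|\mathsf U(F)|^{1/(n+2)}\mathsf U(F)^{-1}N^i-k^{ip}\mu_p\qquad\text{and}\qquad -|\mathsf U(F)|^{1/(n+2)}\mathsf U(F)^{-1}N^i$$ on $\Omega$ are invariant under external reparameterizations and equiaffinely invariant.
   Context: $\mathbb{R}^{n+1}$ has its standard flat connection and volume form $\Psi=dx^1\wedge\dots\wedge dx^{n+1}$. In the coordinates $x^i$: $F_i$, $F_{ij}$ are the first and second partial derivatives of a smooth $F$, $\mathsf H(F)=\det(F_{ij})$, $U^{ij}$ is the adjugate matrix of $(F_{ij})$ (so $U^{ip}F_{pj}=\mathsf H(F)\delta_j{}^i$), $N^i=U^{ip}F_p$, $\mathsf U(F)=U^{ij}F_iF_j$ (summation convention). $\mathscr U(\Omega)=\{F\in C^\infty(\Omega):\mathsf U(F)(x)\ne0\text{ for all }x\in\Omega\}$. For $F\in\mathscr U(\Omega)$: $\Pi_{ij}=F_{ij}-\mathsf U(F)^{-1}\mathsf H(F)F_iF_j$; for any nonvanishing smooth $q$ the tensor $m_{ij}=\Pi_{ij}+q\,\mathsf U(F)^{-1}F_iF_j$ is nondegenerate with inverse $m^{ij}$, and $\Pi^{ij}=m^{ij}-q^{-1}\mathsf U(F)^{-1}N^iN^j$, independent of $q$. Further $k^{ij}=|\mathsf U(F)|^{1/(n+2)}\Pi^{ij}$ and $\mu=(n+2)^{-1}d\log|\mathsf U(F)|$.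 Let $\mathscr A$ be an operator assigning to $F\in\mathscr U(\Omega)$ a smooth vector field $\mathscr A(F)$ on $\Omega$ (given by the same formula on every open domain). It is transverse if $dF(\mathscr A(F))$ is nowhere vanishing on $\Omega$ for every $F\in\mathscr U(\Omega)$. It is invariant under external reparameterizations if for every $F\in\mathscr U(\Omega)$, every connected open $I\subset F(\Omega)$, and every smooth $\psi:I\to\mathbb{R}$ mapping $I$ diffeomorphically onto its image, $\mathscr A(\psi\circ F)^i=\operatorname{sgn}(\dot\psi)\mathscr A(F)^i$ on $\Omega\cap F^{-1}(I)$. For $g$ in the group of affine transformations of $\mathbb{R}^{n+1}$, let $\ell(g)\in GL(n+1,\mathbb{R})$ be its linear part, $L_g(x)=gx$, and $(g\cdot F)(x)=F(g^{-1}x)$. $\mathscr A$ is equiaffinely invariant if for every affine transformation $g$, $L_{g^{-1}}^{\ast}(\mathscr A(F))^i=|\det\ell(g)|^{2/(n+2)}\mathscr A(g\cdot F)^i$ at every $x\in\Omega$ such that $g^{-1}x\in\Omega$, where $L_{g^{-1}}^{\ast}$ is pullback of vector fields, i.e. $(L_{g^{-1}}^{\ast}Y)_x=\ell(g)\,Y_{g^{-1}x}$. *)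

theory Defs
  imports "HOL-Analysis.Analysis"
begin

text \<open>
  The ambient space of dimension n+1 is \<open>real ^ 'n\<close> with \<open>CARD('n) = n + 1\<close>, so that
  \<open>n + 2\<close> is \<open>CARD('n) + 1\<close>. Functions on an open set \<open>\<Omega>\<close> are represented by total
  functions, whose values off \<open>\<Omega>\<close> are irrelevant.
\<close>

section \<open>Smooth functions\<close>

text \<open>Intended for open sets only, since the derivatives are two-sided.\<close>

primrec Ck_on :: "nat \<Rightarrow> 'a::real_normed_vector set \<Rightarrow> ('a \<Rightarrow> 'b::real_normed_vector) \<Rightarrow> bool" where
  "Ck_on 0 S f \<longleftrightarrow> continuous_on S f"
| "Ck_on (Suc k) S f \<longleftrightarrow>
     (\<forall>x\<in>S. f differentiable (at x)) \<and> (\<forall>v. Ck_on k S (\<lambda>x. frechet_derivative f (at x) v))"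

definition smooth_on :: "'a::real_normed_vector set \<Rightarrow> ('a \<Rightarrow> 'b::real_normed_vector) \<Rightarrow> bool" where
  "smooth_on S f \<longleftrightarrow> (\<forall>k. Ck_on k S f)"

definition diffeo_onto_image :: "real set \<Rightarrow> (real \<Rightarrow> real) \<Rightarrow> bool" where
  "diffeo_onto_image I \<psi> \<longleftrightarrow>
     smooth_on I \<psi> \<and> inj_on \<psi> I \<and> open (\<psi> ` I) \<and> smooth_on (\<psi> ` I) (inv_into I \<psi>)"


section \<open>The adjugate matrix\<close>

text \<open>
  The entry \<open>(i, j)\<close> is the \<open>(j, i)\<close>-cofactor: replacing both the row \<open>j\<close> and the column \<open>i\<close>
  by unit vectors yields the signed minor without having to delete indices from the type \<open>'n\<close>.
\<close>

definition adjugate :: "real ^ 'n ^ 'n \<Rightarrow> real ^ 'n ^ 'n" where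
  "adjugate A = (\<chi> i j. det (\<chi> k l. if k = j \<and> l = i then 1
                                   else if k = j \<or> l = i then 0 else A $ k $ l))"

lemma adjugate_transpose: "adjugate (transpose A) = transpose (adjugate A)"
proof -
  have "adjugate (transpose A) $ i $ j = adjugate A $ j $ i" for i j
  proof -
    have eq: "transpose (\<chi> k l. if k = j \<and> l = i then 1
                        else if k = j \<or> l = i then 0 else transpose A $ k $ l)
        = (\<chi> k l. if k = i \<and> l = j then 1
                        else if k = i \<or> l = j then 0 else A $ k $ l)"
      by (auto simp: transpose_def vec_eq_iff)
    then show ?thesis
      unfolding adjugate_def vec_lambda_beta by (simp only: arg_cong[OF eq, of det, unfolded det_transpose])
  qed
  then show ?thesis by (simp add: vec_eq_iff transpose_def)
qed

lemma det_unit_row: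
  fixes y :: "real ^ 'n"
  shows "det ((\<chi> k. if k = i then y else axis k 1) :: real ^ 'n ^ 'n) = y $ i"
proof -
  have s: "sum (\<lambda>j. y $ j *s row j (mat 1 :: real ^ 'n ^ 'n)) UNIV = y"
    by (simp add: vec_eq_iff row_def mat_def if_distrib sum.delta cong: if_cong)
  have r: "row k (mat 1 :: real ^ 'n ^ 'n) = axis k 1" for k
    by (auto simp: vec_eq_iff row_def mat_def axis_def)
  show ?thesis
    using cramer_lemma_transpose[of i y "mat 1 :: real ^ 'n ^ 'n"] unfolding s by (simp only: r) simp
qed

lemma adjugate_column:
  fixes A :: "real ^ 'n ^ 'n"
  shows "adjugate A $ i $ j = det (\<chi> k l. if l = i then axis j 1 $ k else A $ k $ l)"
proof -
  define M :: "real ^ 'n ^ 'n" where "M = (\<chi> k l. if l = i then axis j 1 $ k else A $ k $ l)"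
  define w :: "real ^ 'n" where "w = (\<chi> l. if l = i then 1 else - A $ j $ l)"
  define E :: "real ^ 'n ^ 'n" where "E = (\<chi> k. if k = i then w else axis k 1)"
  have "(M ** E) $ k $ l = (if k = j \<and> l = i then 1
                                   else if k = j \<or> l = i then 0 else A $ k $ l)" for k l
  proof -
    have "(M ** E) $ k $ l = M $ k $ i * w $ l + (\<Sum>p\<in>UNIV - {i}. M $ k $ p * axis p 1 $ l)"
      by (simp add: matrix_matrix_mult_def E_def sum.remove[of _ i])
    also have "(\<Sum>p\<in>UNIV - {i}. M $ k $ p * axis p 1 $ l)
        = (\<Sum>p\<in>UNIV - {i}. if p = l then M $ k $ l else 0)"
      by (intro sum.cong) (auto simp: axis_def)
    also have "\<dots> = (if l = i then 0 else M $ k $ l)"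
      by (simp add: sum.delta)
    finally show ?thesis by (auto simp: M_def w_def axis_def)
  qed
  then have "adjugate A $ i $ j = det (M ** E)"
    unfolding adjugate_def by (auto simp: vec_eq_iff intro!: arg_cong[where f = det])
  also have "\<dots> = det M"
    by (simp add: det_mul E_def det_unit_row) (simp add: w_def)
  finally show ?thesis by (simp add: M_def)
qed

lemma adjugate_mult_vec:
  "(adjugate A *v y) $ i = det (\<chi> k l. if l = i then y $ k else A $ k $ l)"
proof -
  have col: "det (\<chi> k l. if l = i then z $ k else A $ k $ l)
      = det (\<chi> k. if k = i then z else column k A)" for z
  proof -
    have "transpose (\<chi> k l. if l = i then z $ k else A $ k $ l)
        = (\<chi> k. if k = i then z else column k A)"
      by (auto simp: vec_eq_iff transpose_def column_def)
    from arg_cong[OF this, of det] show ?thesis unfolding det_transpose .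
  qed
  have "y = sum (\<lambda>j. y $ j *s axis j 1) UNIV"
    by (simp add: basis_expansion)
  from arg_cong[OF this, of "\<lambda>z. det (\<chi> k. if k = i then z else column k A)"]
  have "det (\<chi> k. if k = i then y else column k A)
      = det (\<chi> k. if k = i then sum (\<lambda>j. y $ j *s axis j 1) UNIV else column k A)"
    .
  also have "\<dots> = (\<Sum>j\<in>UNIV. det (\<chi> k. if k = i then y $ j *s axis j 1 else column k A))"
    using det_linear_row_sum[of UNIV i "\<lambda>_ j. y $ j *s axis j 1" "\<lambda>k. column k A"] by simp
  also have "\<dots> = (\<Sum>j\<in>UNIV. y $ j * adjugate A $ i $ j)"
    using det_row_mul[of i _ "\<lambda>_. axis _ 1" "\<lambda>k. column k A"]
    by (simp add: adjugate_column col)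
  finally show ?thesis
    by (simp add: col matrix_vector_mult_def mult.commute)
qed

lemma adjugate_mult_left: "adjugate A *v (A *v x) = det A *s x"
  by (simp add: vec_eq_iff adjugate_mult_vec cramer_lemma mult.commute)

lemma adjugate_left: "adjugate A ** A = det A *\<^sub>R mat 1"
proof -
  have "(adjugate A ** A) *v x = (det A *\<^sub>R mat 1) *v x" for x
    by (simp add: matrix_vector_mul_assoc[symmetric] adjugate_mult_left
        scaleR_matrix_vector_assoc[symmetric] vec_eq_iff)
  then show ?thesis by (simp add: matrix_eq)
qed

lemma adjugate_right: "A ** adjugate A = det A *\<^sub>R mat 1"
proof -
  have "transpose (A ** adjugate A) = adjugate (transpose A) ** transpose A"
    by (simp add: matrix_transpose_mul adjugate_transpose)
  also have "\<dots> = det A *\<^sub>R mat 1" by (simp add: adjugate_left)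
  finally have "transpose (transpose (A ** adjugate A)) = transpose (det A *\<^sub>R mat 1)" by simp
  then show ?thesis by (simp add: transpose_scalar)
qed


section \<open>The tensors attached to a function\<close>

definition pd :: "'n \<Rightarrow> (real ^ 'n \<Rightarrow> real) \<Rightarrow> real ^ 'n \<Rightarrow> real" where
  "pd i F x = frechet_derivative F (at x) (axis i 1)"

definition grad :: "(real ^ 'n \<Rightarrow> real) \<Rightarrow> real ^ 'n \<Rightarrow> real ^ 'n" where
  "grad F x = (\<chi> i. pd i F x)"

definition hess :: "(real ^ 'n \<Rightarrow> real) \<Rightarrow> real ^ 'n \<Rightarrow> real ^ 'n ^ 'n" where
  "hess F x = (\<chi> i j. pd j (pd i F) x)"

definition Hdet :: "(real ^ 'n \<Rightarrow> real) \<Rightarrow> real ^ 'n \<Rightarrow> real" where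
  "Hdet F x = det (hess F x)"

definition Uadj :: "(real ^ 'n \<Rightarrow> real) \<Rightarrow> real ^ 'n \<Rightarrow> real ^ 'n ^ 'n" where
  "Uadj F x = adjugate (hess F x)"

definition Nvec :: "(real ^ 'n \<Rightarrow> real) \<Rightarrow> real ^ 'n \<Rightarrow> real ^ 'n" where
  "Nvec F x = (\<chi> i. \<Sum>p\<in>UNIV. Uadj F x $ i $ p * grad F x $ p)"

definition UF :: "(real ^ 'n \<Rightarrow> real) \<Rightarrow> real ^ 'n \<Rightarrow> real" where
  "UF F x = (\<Sum>i\<in>UNIV. \<Sum>j\<in>UNIV. Uadj F x $ i $ j * grad F x $ i * grad F x $ j)"

definition Uclass :: "(real ^ 'n) set \<Rightarrow> (real ^ 'n \<Rightarrow> real) set" where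
  "Uclass \<Omega> = {F. smooth_on \<Omega> F \<and> (\<forall>x\<in>\<Omega>. UF F x \<noteq> 0)}"

definition Pi_low :: "(real ^ 'n \<Rightarrow> real) \<Rightarrow> real ^ 'n \<Rightarrow> real ^ 'n ^ 'n" where
  "Pi_low F x =
     (\<chi> i j. hess F x $ i $ j - inverse (UF F x) * Hdet F x * grad F x $ i * grad F x $ j)"

definition m_low :: "(real ^ 'n \<Rightarrow> real) \<Rightarrow> (real ^ 'n \<Rightarrow> real) \<Rightarrow> real ^ 'n \<Rightarrow> real ^ 'n ^ 'n" where
  "m_low q F x =
     (\<chi> i j. Pi_low F x $ i $ j + q x * inverse (UF F x) * grad F x $ i * grad F x $ j)"

definition Pi_up_of :: "(real ^ 'n \<Rightarrow> real) \<Rightarrow> (real ^ 'n \<Rightarrow> real) \<Rightarrow> real ^ 'n \<Rightarrow> real ^ 'n ^ 'n" where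
  "Pi_up_of q F x =
     (\<chi> i j. matrix_inv (m_low q F x) $ i $ j
              - inverse (q x) * inverse (UF F x) * Nvec F x $ i * Nvec F x $ j)"

text \<open>
  The choice \<open>q = 1\<close> is immaterial: see \<open>m_low_invertible\<close> and \<open>Pi_up_of_indep\<close> below.
\<close>

definition Pi_up :: "(real ^ 'n \<Rightarrow> real) \<Rightarrow> real ^ 'n \<Rightarrow> real ^ 'n ^ 'n" where
  "Pi_up = Pi_up_of (\<lambda>_. 1)"

definition k_up :: "(real ^ 'n \<Rightarrow> real) \<Rightarrow> real ^ 'n \<Rightarrow> real ^ 'n ^ 'n" where
  "k_up F x = (\<chi> i j. \<bar>UF F x\<bar> powr (1 / (real CARD('n) + 1)) * Pi_up F x $ i $ j)"

definition mu :: "(real ^ 'n \<Rightarrow> real) \<Rightarrow> real ^ 'n \<Rightarrow> real ^ 'n" where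
  "mu F x = (\<chi> p. 1 / (real CARD('n) + 1) * pd p (\<lambda>y. ln \<bar>UF F y\<bar>) x)"


section \<open>Independence of the auxiliary function\<close>

lemma matrix_inv_both:
  fixes A :: "real ^ 'n ^ 'n"
  assumes "invertible A"
  shows "A ** matrix_inv A = mat 1" "matrix_inv A ** A = mat 1"
  using someI_ex[OF assms[unfolded invertible_def]] by (simp_all add: matrix_inv_def)

lemma Nvec_eq: "Nvec F x = Uadj F x *v grad F x"
  by (simp add: Nvec_def matrix_vector_mult_def)

lemma UF_eq: "UF F x = grad F x \<bullet> Nvec F x"
  by (simp add: UF_def Nvec_def inner_vec_def sum_distrib_left mult_ac)

lemma m_low_mult:
  "m_low q F x *v v
     = hess F x *v v + ((q x - Hdet F x) * inverse (UF F x) * (grad F x \<bullet> v)) *\<^sub>R grad F x"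
  by (simp add: vec_eq_iff m_low_def Pi_low_def matrix_vector_mult_def inner_vec_def
      sum.distrib sum_subtractf sum_distrib_left sum_distrib_right algebra_simps)

context
  fixes F :: "real ^ 'n \<Rightarrow> real" and x :: "real ^ 'n"
  assumes sym: "transpose (hess F x) = hess F x" and U0: "UF F x \<noteq> 0"
begin

lemma m_low_Nvec: "m_low q F x *v Nvec F x = q x *\<^sub>R grad F x"
proof -
  have "hess F x *v Nvec F x = Hdet F x *\<^sub>R grad F x"
    by (simp add: Nvec_eq Uadj_def Hdet_def matrix_vector_mul_assoc adjugate_right
        scaleR_matrix_vector_assoc[symmetric])
  then show ?thesis
    using U0 by (simp add: m_low_mult UF_eq[symmetric] scaleR_left_distrib[symmetric] mult.assoc)
qed

lemma m_low_sym: "transpose (m_low q F x) = m_low q F x"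
  using sym by (simp add: m_low_def Pi_low_def transpose_def vec_eq_iff)

lemma m_low_invertible:
  assumes q: "q x \<noteq> 0"
  shows "invertible (m_low q F x)"
proof -
  have "v = 0" if v: "m_low q F x *v v = 0" for v
  proof (rule ccontr)
    assume "v \<noteq> 0"
    have "0 = Nvec F x \<bullet> (m_low q F x *v v)" by (simp add: v)
    also have "\<dots> = (m_low q F x *v Nvec F x) \<bullet> v"
      by (metis dot_lmul_matrix m_low_sym transpose_matrix_vector)
    finally have fv: "grad F x \<bullet> v = 0" using q by (simp add: m_low_Nvec)
    then have Hv: "hess F x *v v = 0" using v by (simp add: m_low_mult)
    have "(Uadj F x *v grad F x) $ i = 0" for i
    proof -
      define B where "B = transpose (\<chi> k l. if l = i then grad F x $ k else hess F x $ k $ l)"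
      have "(B *v v) $ k = 0" for k
      proof (cases "k = i")
        case True
        then show ?thesis
          using fv by (simp add: B_def transpose_def matrix_vector_mult_def inner_vec_def)
      next
        case False
        have "(B *v v) $ k = (transpose (hess F x) *v v) $ k"
          using False by (simp add: B_def transpose_def matrix_vector_mult_def)
        then show ?thesis using Hv sym by simp
      qed
      then have "B *v v = 0" by (simp add: vec_eq_iff)
      then have "\<not> invertible B"
        using \<open>v \<noteq> 0\<close> by (metis invertible_left_inverse matrix_left_invertible_ker)
      then have "det B = 0" by (simp add: invertible_det_nz)
      then show ?thesis by (simp add: B_def Uadj_def adjugate_mult_vec)
    qed
    then have "Nvec F x = 0" by (simp add: Nvec_eq vec_eq_iff)
    then show False using U0 by (simp add: UF_eq)
  qed
  then show ?thesis by (metis invertible_left_inverse matrix_left_invertible_ker)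
qed

lemma Pi_up_of_indep:
  assumes q: "q x \<noteq> 0"
  shows "Pi_up_of q F x = Pi_up F x"
proof -
  define one where "one = (\<lambda>_ :: real ^ 'n. 1 :: real)"
  define Q where "Q = m_low q F x"
  define M where "M = m_low one F x"
  define N where "N = Nvec F x"
  define f where "f = grad F x"
  define u where "u = UF F x"
  have inv: "invertible Q" "invertible M"
    using m_low_invertible[of q] m_low_invertible[of one] q by (auto simp: Q_def M_def one_def)
  have Qi: "matrix_inv Q *v (Q *v w) = w" "Q *v (matrix_inv Q *v w) = w" for w
    using inv by (simp_all add: matrix_vector_mul_assoc matrix_inv_both)
  have Mi: "matrix_inv M *v (M *v w) = w" for w
    using inv by (simp_all add: matrix_vector_mul_assoc matrix_inv_both)
  have MN: "M *v N = f" using m_low_Nvec[of one] by (simp add: M_def N_def f_def one_def)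
  have MQ: "M *v w = Q *v w + ((1 - q x) * inverse u * (f \<bullet> w)) *\<^sub>R f" for w
    by (simp add: M_def Q_def m_low_mult u_def f_def one_def algebra_simps)
  have QN: "Q *v N = q x *\<^sub>R f" by (simp add: Q_def N_def f_def m_low_Nvec)
  have "Pi_up_of q F x *v z = Pi_up_of one F x *v z" for z
  proof -
    define w where "w = matrix_inv Q *v z"
    have z: "z = Q *v w" by (simp add: w_def Qi)
    have Nz: "N \<bullet> z = q x * (f \<bullet> w)"
    proof -
      have "N \<bullet> z = (Q *v N) \<bullet> w"
        unfolding z Q_def by (metis dot_lmul_matrix m_low_sym transpose_matrix_vector)
      then show ?thesis by (simp add: QN)
    qed
    have "M *v (w - ((1 - q x) * inverse u * (f \<bullet> w)) *\<^sub>R N) = z"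
      by (simp add: matrix_vector_mult_diff_distrib matrix_vector_mult_scaleR MN)
         (simp add: MQ z)
    then have Mz: "matrix_inv M *v z = w - ((1 - q x) * inverse u * (f \<bullet> w)) *\<^sub>R N"
      using Mi by metis
    have P: "Pi_up_of r F x *v z
        = matrix_inv (m_low r F x) *v z - (inverse (r x) * inverse u * (N \<bullet> z)) *\<^sub>R N" for r
      by (simp add: vec_eq_iff Pi_up_of_def matrix_vector_mult_def inner_vec_def N_def u_def
          sum_subtractf sum_distrib_left sum_distrib_right algebra_simps)
    have "Pi_up_of q F x *v z = w - (inverse u * (f \<bullet> w)) *\<^sub>R N"
      using q by (simp add: P Q_def[symmetric] w_def[symmetric] Nz)
    moreover have "Pi_up_of one F x *v z = w - (inverse u * (f \<bullet> w)) *\<^sub>R N"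
      by (simp add: P M_def[symmetric] Mz Nz) (simp add: one_def algebra_simps)
    ultimately show ?thesis by simp
  qed
  then have "Pi_up_of q F x = Pi_up_of one F x" by (simp add: matrix_eq)
  then show ?thesis by (simp add: Pi_up_def one_def)
qed

end


section \<open>Operators and their invariance\<close>

type_synonym 'n operator = "(real ^ 'n \<Rightarrow> real) \<Rightarrow> real ^ 'n \<Rightarrow> real ^ 'n"

text \<open>
  The second clause says that the vector field on \<open>\<Omega>\<close> depends only on the restriction of the
  function to \<open>\<Omega>\<close>. That the same formula is used on every domain is built into the type, as
  \<open>\<A>\<close> does not take \<open>\<Omega>\<close> as an argument.
\<close>

definition vector_field_operator :: "(real ^ 'n) set \<Rightarrow> 'n operator \<Rightarrow> bool" where
  "vector_field_operator \<Omega> \<A> \<longleftrightarrow>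
     (\<forall>F\<in>Uclass \<Omega>. smooth_on \<Omega> (\<A> F)) \<and>
     (\<forall>F\<in>Uclass \<Omega>. \<forall>G\<in>Uclass \<Omega>. (\<forall>x\<in>\<Omega>. F x = G x) \<longrightarrow> (\<forall>x\<in>\<Omega>. \<A> F x = \<A> G x))"

definition transverse :: "(real ^ 'n) set \<Rightarrow> 'n operator \<Rightarrow> bool" where
  "transverse \<Omega> \<A> \<longleftrightarrow>
     (\<forall>F\<in>Uclass \<Omega>. \<forall>x\<in>\<Omega>. frechet_derivative F (at x) (\<A> F x) \<noteq> 0)"

definition external_reparam_invariant :: "(real ^ 'n) set \<Rightarrow> 'n operator \<Rightarrow> bool" where
  "external_reparam_invariant \<Omega> \<A> \<longleftrightarrow>
     (\<forall>F\<in>Uclass \<Omega>. \<forall>I \<psi>. open I \<and> connected I \<and> I \<subseteq> F ` \<Omega> \<and> diffeo_onto_image I \<psi> \<longrightarrow>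
        (\<forall>x\<in>\<Omega> \<inter> F -` I. \<A> (\<psi> \<circ> F) x = sgn (deriv \<psi> (F x)) *\<^sub>R \<A> F x))"

definition equiaffinely_invariant :: "(real ^ 'n) set \<Rightarrow> 'n operator \<Rightarrow> bool" where
  "equiaffinely_invariant \<Omega> \<A> \<longleftrightarrow>
     (\<forall>F\<in>Uclass \<Omega>. \<forall>(L :: real ^ 'n ^ 'n) b. invertible L \<longrightarrow>
        (let g = (\<lambda>x. L *v x + b) in
         \<forall>x\<in>\<Omega>. inv g x \<in> \<Omega> \<longrightarrow>
           L *v \<A> F (inv g x) = (\<bar>det L\<bar> powr (2 / (real CARD('n) + 1))) *\<^sub>R \<A> (F \<circ> inv g) x))"

definition W0_op :: "'n::finite operator" where
  "W0_op F x =
     (\<chi> i. - (\<bar>UF F x\<bar> powr (1 / (real CARD('n) + 1)) * inverse (UF F x) * Nvec F x $ i))"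

definition W_op :: "'n::finite operator" where
  "W_op F x =
     (\<chi> i. - (\<bar>UF F x\<bar> powr (1 / (real CARD('n) + 1)) * inverse (UF F x) * Nvec F x $ i)
            - (\<Sum>p\<in>UNIV. k_up F x $ i $ p * mu F x $ p))"

end

theory Submission
  imports Defs
begin

text \<open>
  Wherever \<open>U(F) \<noteq> 0\<close>, the tensor \<open>\<Pi>\<^sup>i\<^sup>j\<close> is the unique matrix \<open>P\<close> with \<open>P dF = 0\<close> and
  \<open>P (Hess F) w = w - U(F)\<inverse> dF(w) N\<close> for all \<open>w\<close>. This reduces its behaviour under \<open>F \<mapsto> \<psi> \<circ> F\<close> and
  under affine changes of coordinates to that of \<open>dF\<close>, \<open>Hess F\<close>, \<open>N\<close> and \<open>U(F)\<close>, which follow from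
  the chain rule and from identities for adjugates of products and of rank one perturbations.
  Passing to \<open>\<psi> \<circ> F\<close> changes \<open>\<mu>\<close> by a multiple of \<open>dF\<close>, which \<open>\<Pi>\<close> annihilates. As \<open>\<Pi>\<close> takes
  values in the kernel of \<open>dF\<close>, both operators have the same, nonvanishing, transverse component.
\<close>

section \<open>First derivatives and their locality\<close>

lemma frechet_derivative_eqI:
  "(f has_derivative f') (at x) \<Longrightarrow> frechet_derivative f (at x) = f'"
  by (metis frechet_derivative_at)

lemma frechet_derivative_has_derivative:
  "f differentiable (at x) \<Longrightarrow> (f has_derivative frechet_derivative f (at x)) (at x)"
  by (simp add: frechet_derivative_works)

text \<open>\<open>frechet_derivative\<close> is a choice among the derivatives at the point. Both
  functions admit the same ones there, so the choices agree even where neither function is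
  differentiable.\<close>

lemma frechet_derivative_cong_open:
  assumes "open S" "x \<in> S" "\<And>y. y \<in> S \<Longrightarrow> f y = g y"
  shows "frechet_derivative f (at x) = frechet_derivative g (at x)"
proof -
  have "(f has_derivative f') (at x) \<longleftrightarrow> (g has_derivative f') (at x)" for f'
    using has_derivative_transform_within_open[OF _ assms(1,2)] assms(3) by metis
  then show ?thesis by (simp add: frechet_derivative_def)
qed

section \<open>Closure properties of smooth functions\<close>

lemma Ck_on_cong:
  assumes "open S" "\<And>x. x \<in> S \<Longrightarrow> f x = g x" "Ck_on k S f"
  shows "Ck_on k S g"
  using assms(2,3)
proof (induction k arbitrary: f g)
  case 0
  then show ?case using continuous_on_cong[of S S f g] by auto
next
  case (Suc k)
  have d: "g differentiable (at x)" if "x \<in> S" for x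
  proof -
    obtain D where "(f has_derivative D) (at x)"
      using Suc.prems(2) \<open>x \<in> S\<close> by (auto simp: differentiable_def)
    from has_derivative_transform_within_open[OF this \<open>open S\<close> \<open>x \<in> S\<close> Suc.prems(1)]
    show ?thesis by (rule differentiableI)
  qed
  have "Ck_on k S (\<lambda>x. frechet_derivative g (at x) v)" for v
  proof (rule Suc.IH)
    show "frechet_derivative f (at x) v = frechet_derivative g (at x) v" if "x \<in> S" for x
      by (rule fun_cong[OF frechet_derivative_cong_open[OF \<open>open S\<close> that]]) (rule Suc.prems(1))
    show "Ck_on k S (\<lambda>x. frechet_derivative f (at x) v)"
      using Suc.prems(2) by simp
  qed
  with d show ?case by simp
qed

text \<open>The common entry point of the closure proofs below: the derivative is supplied by an
  explicit formula on the open set, and locality transfers its regularity to the chosen one.\<close>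

lemma Ck_on_SucI:
  assumes f': "\<And>x. x \<in> S \<Longrightarrow> (f has_derivative f' x) (at x)"
    and Ck: "\<And>v. Ck_on k S (\<lambda>x. f' x v)" and S: "open S"
  shows "Ck_on (Suc k) S f"
proof -
  have "f differentiable (at x)" if "x \<in> S" for x
    using f'[OF that] by (rule differentiableI)
  moreover have "Ck_on k S (\<lambda>x. frechet_derivative f (at x) v)" for v
    by (rule Ck_on_cong[OF S _ Ck[of v]]) (simp add: frechet_derivative_eqI[OF f'])
  ultimately show ?thesis by simp
qed

lemma Ck_on_SucD: "Ck_on (Suc k) S f \<Longrightarrow> Ck_on k S f"
proof (induction k arbitrary: f)
  case 0
  then show ?case
    by (auto intro!: continuous_at_imp_continuous_on differentiable_imp_continuous_within)
next
  case (Suc k)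
  then show ?case by (metis Ck_on.simps(2))
qed

lemma Ck_on_subset: "Ck_on k S f \<Longrightarrow> T \<subseteq> S \<Longrightarrow> Ck_on k T f"
  by (induction k arbitrary: f) (auto intro: continuous_on_subset)

lemma smooth_on_subset: "smooth_on S f \<Longrightarrow> T \<subseteq> S \<Longrightarrow> smooth_on T f"
  unfolding smooth_on_def by (blast intro: Ck_on_subset)

lemma smooth_on_cong:
  "open S \<Longrightarrow> (\<And>x. x \<in> S \<Longrightarrow> f x = g x) \<Longrightarrow> smooth_on S f \<Longrightarrow> smooth_on S g"
  unfolding smooth_on_def by (blast intro: Ck_on_cong)

lemma smooth_on_differentiable: "smooth_on S f \<Longrightarrow> x \<in> S \<Longrightarrow> f differentiable (at x)"
  unfolding smooth_on_def by (metis Ck_on.simps(2))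

lemma smooth_on_frechet_derivative:
  "smooth_on S f \<Longrightarrow> smooth_on S (\<lambda>x. frechet_derivative f (at x) v)"
  unfolding smooth_on_def by (metis Ck_on.simps(2))

lemma smooth_on_continuous: "smooth_on S f \<Longrightarrow> continuous_on S f"
  unfolding smooth_on_def by (metis Ck_on.simps(1))

lemma Ck_on_const: "Ck_on k S (\<lambda>x. c)"
  by (induction k arbitrary: c) auto

lemma Ck_on_add:
  assumes "open S" "Ck_on k S f" "Ck_on k S g"
  shows "Ck_on k S (\<lambda>x. f x + g x)"
  using assms(2,3)
proof (induction k arbitrary: f g)
  case (Suc k)
  show ?case
  proof (rule Ck_on_SucI[OF _ _ \<open>open S\<close>])
    show "((\<lambda>x. f x + g x) has_derivative
        (\<lambda>v. frechet_derivative f (at x) v + frechet_derivative g (at x) v)) (at x)"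
      if "x \<in> S" for x
      using Suc.prems that by (auto intro!: has_derivative_add frechet_derivative_has_derivative)
  qed (use Suc in auto)
qed (auto intro: continuous_on_add)

lemma Ck_on_mult:
  fixes f g :: "'a::real_normed_vector \<Rightarrow> real"
  assumes "open S" "Ck_on k S f" "Ck_on k S g"
  shows "Ck_on k S (\<lambda>x. f x * g x)"
  using assms(2,3)
proof (induction k arbitrary: f g)
  case (Suc k)
  show ?case
  proof (rule Ck_on_SucI[OF _ _ \<open>open S\<close>])
    show "((\<lambda>x. f x * g x) has_derivative
        (\<lambda>v. f x * frechet_derivative g (at x) v + frechet_derivative f (at x) v * g x)) (at x)"
      if "x \<in> S" for x
      using Suc.prems that by (auto intro!: has_derivative_mult frechet_derivative_has_derivative)
    show "Ck_on k S (\<lambda>x. f x * frechet_derivative g (at x) v + frechet_derivative f (at x) v * g x)"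
      for v
      \<comment> \<open>The product rule mixes derivatives, of class k, with undifferentiated
        factors, whose order must first be lowered to k. The induction varies both factors, so it
        applies to these new products.\<close>
      using Suc.prems Ck_on_SucD by (intro Ck_on_add Suc.IH \<open>open S\<close>) auto
  qed
qed (auto intro: continuous_on_mult)

lemma Ck_on_inverse:
  fixes f :: "'a::real_normed_vector \<Rightarrow> real"
  assumes "open S" "\<And>x. x \<in> S \<Longrightarrow> f x \<noteq> 0" "Ck_on k S f"
  shows "Ck_on k S (\<lambda>x. inverse (f x))"
  using assms(3)
proof (induction k)
  case 0
  then show ?case using assms(2) by (auto intro: continuous_on_inverse)
next
  case (Suc k)
  show ?case
  proof (rule Ck_on_SucI[OF _ _ \<open>open S\<close>])
    show "((\<lambda>x. inverse (f x)) has_derivative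
        (\<lambda>v. - (inverse (f x) * frechet_derivative f (at x) v * inverse (f x)))) (at x)"
      if "x \<in> S" for x
      using Suc.prems that
      by (intro Deriv.has_derivative_inverse assms(2) frechet_derivative_has_derivative) auto
    have "Ck_on k S (\<lambda>x. (- 1) * (inverse (f x) * frechet_derivative f (at x) v * inverse (f x)))" for v
      using Suc.prems Ck_on_SucD[OF Suc.prems] by (intro Ck_on_mult Ck_on_const Suc.IH \<open>open S\<close>) auto
    then show "Ck_on k S (\<lambda>x. - (inverse (f x) * frechet_derivative f (at x) v * inverse (f x)))" for v
      by simp
  qed
qed

section \<open>Logarithms and real powers of absolute values\<close>

lemma DERIV_ln_abs:
  fixes y :: real
  assumes "y \<noteq> 0"
  shows "((\<lambda>y. ln \<bar>y\<bar>) has_real_derivative inverse y) (at y)"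
proof -
  \<comment> \<open>Squaring removes the absolute value; since \<open>ln 0 = 0\<close>, the identity
    also holds at 0 and can be substituted under the binder.\<close>
  have e: "ln \<bar>y\<bar> = ln (y\<^sup>2) / 2" for y :: real
    using ln_realpow[of "\<bar>y\<bar>" 2] by (cases "y = 0") simp_all
  show ?thesis unfolding e using assms
    by (auto intro!: derivative_eq_intros simp: field_simps power2_eq_square zero_less_mult_iff)
qed

text \<open>Writing the derivative with |y|^s / y rather than with the power s - 1 covers both signs
  of y and keeps the exponent, so the induction in \<open>Ck_on_abs_powr\<close> meets the same
  function again.\<close>

lemma DERIV_abs_powr:
  fixes y :: real
  assumes "y \<noteq> 0"
  shows "((\<lambda>y. \<bar>y\<bar> powr s) has_real_derivative s * (\<bar>y\<bar> powr s * inverse y)) (at y)"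
proof -
  have "((\<lambda>y. exp (s * ln \<bar>y\<bar>)) has_real_derivative s * (\<bar>y\<bar> powr s * inverse y)) (at y)"
    using DERIV_chain2[OF DERIV_exp DERIV_cmult[OF DERIV_ln_abs[OF assms], of s]] assms
    by (simp add: powr_def mult_ac)
  then show ?thesis
  proof (rule has_field_derivative_transform_within_open)
    \<comment> \<open>By convention \<open>0 powr s\<close> is 0, whereas
      \<open>exp (s * ln 0)\<close> is 1, so the two expressions agree only off the origin.\<close>
    show "open (- {0 :: real})" by (rule open_Compl) simp
    show "y \<in> - {0}" using assms by simp
    show "exp (s * ln \<bar>z\<bar>) = \<bar>z\<bar> powr s" if "z \<in> - {0}" for z
      using that by (simp add: powr_def)
  qed
qed

lemma Ck_on_abs_powr:
  fixes f :: "'a::real_normed_vector \<Rightarrow> real"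
  assumes "open S" "\<And>x. x \<in> S \<Longrightarrow> f x \<noteq> 0" "Ck_on k S f"
  shows "Ck_on k S (\<lambda>x. \<bar>f x\<bar> powr s)"
  using assms(3)
proof (induction k)
  case 0
  have "continuous_on S (\<lambda>x. \<bar>f x\<bar> powr s)"
  proof (rule continuous_on_powr)
    show "continuous_on S (\<lambda>x. \<bar>f x\<bar>)" using 0 by (intro continuous_on_rabs) simp
    show "\<forall>x\<in>S. \<bar>f x\<bar> \<noteq> 0" using assms(2) by simp
  qed (rule continuous_on_const)
  then show ?case by simp
next
  case (Suc k)
  show ?case
  proof (rule Ck_on_SucI[OF _ _ \<open>open S\<close>])
    show "((\<lambda>x. \<bar>f x\<bar> powr s) has_derivative
        (\<lambda>v. s * (\<bar>f x\<bar> powr s * inverse (f x)) * frechet_derivative f (at x) v)) (at x)"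
      if "x \<in> S" for x
    proof -
      have f: "(f has_derivative frechet_derivative f (at x)) (at x)"
        using Suc.prems that by (intro frechet_derivative_has_derivative) simp
      show ?thesis
        using has_derivative_compose[OF f
            DERIV_abs_powr[OF assms(2)[OF that], unfolded has_field_derivative_def]] .
    qed
    show "Ck_on k S (\<lambda>x. s * (\<bar>f x\<bar> powr s * inverse (f x)) * frechet_derivative f (at x) v)" for v
      using Suc.prems Ck_on_SucD[OF Suc.prems] assms(2)
      by (intro Ck_on_mult Ck_on_const Suc.IH Ck_on_inverse \<open>open S\<close>) auto
  qed
qed

lemma Ck_on_vec:
  fixes f :: "'a::real_normed_vector \<Rightarrow> real ^ 'n"
  assumes "open S" "\<And>i. Ck_on k S (\<lambda>x. f x $ i)"
  shows "Ck_on k S f"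
  using assms(2)
proof (induction k arbitrary: f)
  case 0
  then show ?case
    using continuous_on_vec_lambda[of S "\<lambda>i x. f x $ i"] by simp
next
  case (Suc k)
  show ?case
  proof (rule Ck_on_SucI[OF _ _ \<open>open S\<close>])
    show "(f has_derivative (\<lambda>v. \<chi> i. frechet_derivative (\<lambda>x. f x $ i) (at x) v)) (at x)"
      if "x \<in> S" for x
    proof -
      have "((\<lambda>x. f x $ i) has_derivative frechet_derivative (\<lambda>x. f x $ i) (at x)) (at x)" for i
        using Suc.prems[of i] that by (intro frechet_derivative_has_derivative) simp
      then have "((\<lambda>x. f x \<bullet> b) has_derivative
          (\<lambda>v. (\<chi> i. frechet_derivative (\<lambda>x. f x $ i) (at x) v) \<bullet> b)) (at x)"
        if "b \<in> Basis" for b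
        using that by (auto simp: Basis_vec_def inner_axis)
      then show ?thesis
        using has_derivative_componentwise_within[of f _ x UNIV] by blast
    qed
  qed (use Suc in simp)
qed

section \<open>The algebra of smooth functions\<close>

lemma smooth_on_const: "smooth_on S (\<lambda>x. c)"
  by (simp add: smooth_on_def Ck_on_const)

lemma smooth_on_add:
  "open S \<Longrightarrow> smooth_on S f \<Longrightarrow> smooth_on S g \<Longrightarrow> smooth_on S (\<lambda>x. f x + g x)"
  by (simp add: smooth_on_def Ck_on_add)

context
  fixes S :: "'a::real_normed_vector set"
  assumes S: "open S"
begin

lemma smooth_on_mult:
  fixes f g :: "'a \<Rightarrow> real"
  shows "smooth_on S f \<Longrightarrow> smooth_on S g \<Longrightarrow> smooth_on S (\<lambda>x. f x * g x)"
  using S by (simp add: smooth_on_def Ck_on_mult)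

lemma smooth_on_minus:
  fixes f :: "'a \<Rightarrow> real"
  shows "smooth_on S f \<Longrightarrow> smooth_on S (\<lambda>x. - f x)"
  using smooth_on_mult[OF smooth_on_const[of S "- 1"]] by simp

lemma smooth_on_diff:
  fixes f g :: "'a \<Rightarrow> real"
  shows "smooth_on S f \<Longrightarrow> smooth_on S g \<Longrightarrow> smooth_on S (\<lambda>x. f x - g x)"
  using smooth_on_add[OF S _ smooth_on_minus] by simp

lemma smooth_on_sum:
  "(\<And>i. i \<in> I \<Longrightarrow> smooth_on S (f i)) \<Longrightarrow> smooth_on S (\<lambda>x. \<Sum>i\<in>I. f i x)"
  by (induction I rule: infinite_finite_induct) (simp_all add: smooth_on_const smooth_on_add S)

lemma smooth_on_prod:
  fixes f :: "'i \<Rightarrow> 'a \<Rightarrow> real"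
  shows "(\<And>i. i \<in> I \<Longrightarrow> smooth_on S (f i)) \<Longrightarrow> smooth_on S (\<lambda>x. \<Prod>i\<in>I. f i x)"
  by (induction I rule: infinite_finite_induct) (simp_all add: smooth_on_const smooth_on_mult)

lemma smooth_on_inverse:
  fixes f :: "'a \<Rightarrow> real"
  shows "(\<And>x. x \<in> S \<Longrightarrow> f x \<noteq> 0) \<Longrightarrow> smooth_on S f \<Longrightarrow> smooth_on S (\<lambda>x. inverse (f x))"
  using S by (simp add: smooth_on_def Ck_on_inverse)

lemma smooth_on_abs_powr:
  fixes f :: "'a \<Rightarrow> real"
  shows "(\<And>x. x \<in> S \<Longrightarrow> f x \<noteq> 0) \<Longrightarrow> smooth_on S f \<Longrightarrow> smooth_on S (\<lambda>x. \<bar>f x\<bar> powr s)"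
  using S by (simp add: smooth_on_def Ck_on_abs_powr)

lemma smooth_on_vec:
  fixes f :: "'a \<Rightarrow> real ^ 'n"
  shows "(\<And>i. smooth_on S (\<lambda>x. f x $ i)) \<Longrightarrow> smooth_on S f"
  using S by (simp add: smooth_on_def Ck_on_vec)

lemma smooth_on_det:
  fixes A :: "'a \<Rightarrow> real ^ 'n ^ 'n"
  shows "(\<And>i j. smooth_on S (\<lambda>x. A x $ i $ j)) \<Longrightarrow> smooth_on S (\<lambda>x. det (A x))"
  unfolding det_def by (intro smooth_on_sum smooth_on_mult smooth_on_prod smooth_on_const)

lemma smooth_on_adjugate:
  fixes A :: "'a \<Rightarrow> real ^ 'n ^ 'n"
  assumes "\<And>i j. smooth_on S (\<lambda>x. A x $ i $ j)"
  shows "smooth_on S (\<lambda>x. adjugate (A x) $ i $ j)"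
proof -
  have "smooth_on S (\<lambda>x. if k = j \<and> l = i then 1 else if k = j \<or> l = i then 0 else A x $ k $ l)"
    for k l
    using assms by (cases "k = j"; cases "l = i"; simp add: smooth_on_const)
  then show ?thesis by (simp add: adjugate_def smooth_on_det)
qed

end

section \<open>Symmetry of the second derivative\<close>

lemma DERIV_along_line:
  fixes f :: "'a::real_normed_vector \<Rightarrow> real"
  assumes "f differentiable (at (y + t *\<^sub>R w))"
  shows "((\<lambda>t. f (y + t *\<^sub>R w)) has_real_derivative frechet_derivative f (at (y + t *\<^sub>R w)) w) (at t)"
proof -
  let ?D = "frechet_derivative f (at (y + t *\<^sub>R w))"
  have D: "(f has_derivative ?D) (at (y + t *\<^sub>R w))"
    by (rule frechet_derivative_has_derivative[OF assms])
  have "((\<lambda>t. y + t *\<^sub>R w) has_derivative (\<lambda>h. h *\<^sub>R w)) (at t)"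
    by (auto intro!: derivative_eq_intros)
  from has_derivative_compose[OF this D] have "((\<lambda>t. f (y + t *\<^sub>R w)) has_derivative (\<lambda>h. ?D (h *\<^sub>R w))) (at t)" .
  moreover have "(\<lambda>h. ?D (h *\<^sub>R w)) = (*) (?D w)"
    using linear_frechet_derivative[OF assms] by (simp add: linear_scale mult.commute fun_eq_iff)
  ultimately show ?thesis by (simp add: has_field_derivative_def)
qed

text \<open>The mean value theorem is used twice: in direction u for the difference of f along two
  parallel segments, then in direction v for the derivative of f along u.\<close>

lemma second_difference_eq:
  fixes f :: "'a::real_normed_vector \<Rightarrow> real"
  assumes f: "\<And>y. y \<in> ball x e \<Longrightarrow> f differentiable (at y)"
    and f': "\<And>y. y \<in> ball x e \<Longrightarrow> (\<lambda>z. frechet_derivative f (at z) u) differentiable (at y)"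
    and s: "0 < s" "s * (norm u + norm v) < e"
  shows "\<exists>p\<in>ball x e. f (x + s *\<^sub>R u + s *\<^sub>R v) - f (x + s *\<^sub>R u) - f (x + s *\<^sub>R v) + f x
      = s * (s * frechet_derivative (\<lambda>z. frechet_derivative f (at z) u) (at p) v)"
proof -
  let ?D = "\<lambda>z. frechet_derivative f (at z) u"
  \<comment> \<open>The whole parallelogram with sides s u and s v lies in the ball, so both
    segments stay where f is controlled.\<close>
  have b: "x + a *\<^sub>R u + c *\<^sub>R v \<in> ball x e" if "0 \<le> a" "a \<le> s" "0 \<le> c" "c \<le> s" for a c
  proof -
    have "norm (a *\<^sub>R u + c *\<^sub>R v) \<le> a * norm u + c * norm v"
      using norm_triangle_ineq[of "a *\<^sub>R u" "c *\<^sub>R v"] that by simp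
    also have "\<dots> \<le> s * norm u + s * norm v"
      using that by (intro add_mono mult_right_mono) auto
    also have "\<dots> < e" using s by (simp add: distrib_left)
    finally show ?thesis
      using norm_minus_cancel[of "a *\<^sub>R u + c *\<^sub>R v"] by (simp add: dist_norm)
  qed
  define g where "g = (\<lambda>t. f ((x + s *\<^sub>R v) + t *\<^sub>R u) - f (x + t *\<^sub>R u))"
  have "\<exists>z>0. z < s \<and> g s - g 0 = (s - 0) * (?D ((x + s *\<^sub>R v) + z *\<^sub>R u) - ?D (x + z *\<^sub>R u))"
  proof (rule MVT2[OF s(1)])
    fix t assume t: "0 \<le> t" "t \<le> s"
    have "f differentiable (at ((x + s *\<^sub>R v) + t *\<^sub>R u))" "f differentiable (at (x + t *\<^sub>R u))"
      using f[OF b[of t s]] f[OF b[of t 0]] t s by (simp_all add: add_ac)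
    then show "(g has_real_derivative ?D ((x + s *\<^sub>R v) + t *\<^sub>R u) - ?D (x + t *\<^sub>R u)) (at t)"
      unfolding g_def by (intro DERIV_diff DERIV_along_line)
  qed
  then obtain z where z: "0 < z" "z < s"
    and gz: "g s - g 0 = s * (?D ((x + s *\<^sub>R v) + z *\<^sub>R u) - ?D (x + z *\<^sub>R u))"
    by auto
  let ?E = "\<lambda>p. frechet_derivative ?D (at p) v"
  have "\<exists>w>0. w < s \<and> ?D ((x + z *\<^sub>R u) + s *\<^sub>R v) - ?D ((x + z *\<^sub>R u) + 0 *\<^sub>R v)
      = (s - 0) * ?E ((x + z *\<^sub>R u) + w *\<^sub>R v)"
    using z by (intro MVT2[OF s(1)] DERIV_along_line f' b) auto
  then obtain w where w: "0 < w" "w < s"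
    and Dw: "?D ((x + z *\<^sub>R u) + s *\<^sub>R v) - ?D (x + z *\<^sub>R u) = s * ?E ((x + z *\<^sub>R u) + w *\<^sub>R v)"
    by auto
  have "g s - g 0 = s * (s * ?E ((x + z *\<^sub>R u) + w *\<^sub>R v))"
    unfolding gz using Dw by (simp add: add_ac)
  moreover have "g s - g 0
      = f (x + s *\<^sub>R u + s *\<^sub>R v) - f (x + s *\<^sub>R u) - f (x + s *\<^sub>R v) + f x"
    by (simp add: g_def add_ac)
  ultimately show ?thesis
    using b[of z w] z w by force
qed

text \<open>The second difference is symmetric in u and v, so the two mixed derivatives take equal
  values at some points p and q near x; continuity at x then makes them equal there.\<close>

lemma frechet_derivative_commute:
  fixes f :: "'a::real_normed_vector \<Rightarrow> real"
  assumes "open S" "x \<in> S" and f: "smooth_on S f"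
  shows "frechet_derivative (\<lambda>z. frechet_derivative f (at z) u) (at x) v
       = frechet_derivative (\<lambda>z. frechet_derivative f (at z) v) (at x) u"
proof -
  define D where "D = (\<lambda>u v p. frechet_derivative (\<lambda>z. frechet_derivative f (at z) u) (at p) v)"
  have cont: "isCont (D u v) x" for u v
    using smooth_on_continuous[OF smooth_on_frechet_derivative[OF smooth_on_frechet_derivative[OF f]]]
      assms(1,2) by (auto simp: D_def continuous_on_eq_continuous_at)
  have "\<bar>D u v x - D v u x\<bar> \<le> \<epsilon>" if "\<epsilon> > 0" for \<epsilon> :: real
  proof -
    have "\<forall>\<^sub>F p in nhds x. \<bar>D u v p - D u v x\<bar> < \<epsilon> / 2 \<and> \<bar>D v u p - D v u x\<bar> < \<epsilon> / 2 \<and> p \<in> S"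
      using cont[of u v] cont[of v u] that eventually_nhds_in_open[OF assms(1,2)]
        tendstoD[of "D u v" "D u v x" "nhds x" "\<epsilon> / 2"] tendstoD[of "D v u" "D v u x" "nhds x" "\<epsilon> / 2"]
      by (simp add: isCont_def tendsto_at_iff_tendsto_nhds dist_real_def eventually_conj_iff)
    then obtain e where e: "e > 0"
      and near: "\<And>p. p \<in> ball x e \<Longrightarrow> \<bar>D u v p - D u v x\<bar> < \<epsilon> / 2 \<and> \<bar>D v u p - D v u x\<bar> < \<epsilon> / 2 \<and> p \<in> S"
      by (auto simp: eventually_nhds_metric dist_commute)
    \<comment> \<open>The summand 1 keeps the denominator positive even for u = v = 0.\<close>
    define s where "s = e / (2 * (norm u + norm v + 1))"
    have n: "norm u + norm v + 1 > 0" by (simp add: add_nonneg_pos)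
    then have s: "s > 0" using e by (simp add: s_def)
    have "s * (norm u + norm v) < s * (2 * (norm u + norm v + 1))"
      using s n by (intro mult_strict_left_mono) auto
    also have "\<dots> = e" using n by (simp add: s_def)
    finally have se: "s * (norm u + norm v) < e" .
    have d: "f differentiable (at y)" "(\<lambda>z. frechet_derivative f (at z) w) differentiable (at y)"
      if "y \<in> ball x e" for y w
      using smooth_on_differentiable[OF f] near[OF that]
        smooth_on_differentiable[OF smooth_on_frechet_derivative[OF f]] by auto
    obtain p where p: "p \<in> ball x e"
      "f (x + s *\<^sub>R u + s *\<^sub>R v) - f (x + s *\<^sub>R u) - f (x + s *\<^sub>R v) + f x = s * (s * D u v p)"
      unfolding D_def using second_difference_eq[of x e f u s v, OF d(1) d(2) s se] by blast
    have se': "s * (norm v + norm u) < e" using se by (simp add: add.commute)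
    obtain q where q: "q \<in> ball x e"
      "f (x + s *\<^sub>R v + s *\<^sub>R u) - f (x + s *\<^sub>R v) - f (x + s *\<^sub>R u) + f x = s * (s * D v u q)"
      unfolding D_def using second_difference_eq[of x e f v s u, OF d(1) d(2) s se'] by blast
    have "s * (s * D u v p) = s * (s * D v u q)"
    proof -
      have e: "x + s *\<^sub>R v + s *\<^sub>R u = x + s *\<^sub>R u + s *\<^sub>R v" by (simp add: add_ac)
      show ?thesis using p(2) q(2)[unfolded e] by linarith
    qed
    then have "D u v p = D v u q" using s by simp
    then show ?thesis using near[OF p(1)] near[OF q(1)] by linarith
  qed
  then have "\<bar>D u v x - D v u x\<bar> \<le> 0" by (rule field_le_epsilon[of _ 0, simplified])
  then show ?thesis by (simp add: D_def)
qed


section \<open>Adjugates of products and of rank one perturbations\<close>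

text \<open>By Cramer's rule: replacing column i of A K by A y gives A times the matrix K with
  column i replaced by y. This form holds for singular A as well.\<close>

lemma adjugate_mult_factor_right:
  fixes A K :: "real ^ 'n ^ 'n"
  shows "adjugate (A ** K) ** A = det A *\<^sub>R adjugate K"
proof -
  have "(adjugate (A ** K) *v (A *v y)) $ i = det A * (adjugate K *v y) $ i" for y i
  proof -
    have "(\<chi> k l. if l = i then (A *v y) $ k else (A ** K) $ k $ l)
        = A ** (\<chi> k l. if l = i then y $ k else K $ k $ l)"
      by (simp add: vec_eq_iff matrix_matrix_mult_def matrix_vector_mult_def)
    then show ?thesis by (simp add: adjugate_mult_vec det_mul)
  qed
  then show ?thesis
    by (simp add: matrix_eq vec_eq_iff matrix_vector_mul_assoc[symmetric]
        scaleR_matrix_vector_assoc[symmetric])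
qed

lemma adjugate_mult_factor_left:
  fixes B K :: "real ^ 'n ^ 'n"
  shows "B ** adjugate (K ** B) = det B *\<^sub>R adjugate K"
proof -
  have "transpose (B ** adjugate (K ** B)) = transpose (det B *\<^sub>R adjugate K)"
    using adjugate_mult_factor_right[of "transpose B" "transpose K"]
    by (simp add: matrix_transpose_mul adjugate_transpose[symmetric] transpose_scalar)
  then show ?thesis by (metis transpose_transpose)
qed

text \<open>By Cramer's rule, component i on the left is the determinant of K with column i replaced
  by f. The rank one term adds multiples of f to the other columns, which column operations remove;
  each of those columns then still carries a factor a.\<close>

lemma adjugate_rank_one:
  fixes H K :: "real ^ 'n ^ 'n"
  assumes K: "\<And>k l. K $ k $ l = a * H $ k $ l + b * f $ k * f $ l"
  shows "adjugate K *v f = a ^ (CARD('n) - 1) *\<^sub>R (adjugate H *v f)"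
proof -
  have "(adjugate K *v f) $ i = a ^ (CARD('n) - 1) * (adjugate H *v f) $ i" for i
  proof -
    define R :: "real ^ 'n ^ 'n" where "R = (\<chi> k l. if l = i then f $ k else H $ k $ l)"
    \<comment> \<open>D scales every column except column i by a, and E adds the multiples b f_l of
      column i to the other columns.\<close>
    define d where "d = (\<lambda>l. if l = i then 1 else a)"
    define D :: "real ^ 'n ^ 'n" where "D = (\<chi> k l. if k = l then d k else 0)"
    define w :: "real ^ 'n" where "w = (\<chi> l. if l = i then 1 else b * f $ l)"
    define E :: "real ^ 'n ^ 'n" where "E = (\<chi> k. if k = i then w else axis k 1)"
    have RD: "(R ** D) $ k $ l = R $ k $ l * d l" for k l
      by (simp add: matrix_matrix_mult_def D_def if_distrib cong: if_cong)
    have "(R ** D ** E) $ k $ l = (if l = i then f $ k else K $ k $ l)" for k l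
    proof -
      have "(R ** D ** E) $ k $ l = (\<Sum>p\<in>UNIV. R $ k $ p * d p * E $ p $ l)"
        unfolding matrix_matrix_mult_def[of "R ** D" E] by (simp add: RD)
      also have "\<dots> = f $ k * w $ l + (\<Sum>p\<in>UNIV - {i}. R $ k $ p * d p * E $ p $ l)"
        by (simp add: sum.remove[of _ i] R_def d_def E_def)
      also have "(\<Sum>p\<in>UNIV - {i}. R $ k $ p * d p * E $ p $ l)
          = (\<Sum>p\<in>UNIV - {i}. if p = l then a * H $ k $ l else 0)"
        by (intro sum.cong) (auto simp: axis_def R_def d_def E_def)
      also have "\<dots> = (if l = i then 0 else a * H $ k $ l)"
        by (simp add: sum.delta)
      finally show ?thesis by (auto simp: w_def K)
    qed
    then have "(adjugate K *v f) $ i = det (R ** D ** E)"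
      unfolding adjugate_mult_vec by (intro arg_cong[where f = det]) (simp add: vec_eq_iff)
    moreover have "det E = 1" by (simp add: E_def det_unit_row) (simp add: w_def)
    moreover have "det D = a ^ (CARD('n) - 1)"
    proof -
      have "det D = prod d UNIV"
        by (subst det_diagonal) (auto simp: D_def)
      also have "\<dots> = d i * prod d (UNIV - {i})" by (simp add: prod.remove)
      also have "prod d (UNIV - {i}) = (\<Prod>p\<in>UNIV - {i}. a)"
        by (intro prod.cong) (auto simp: d_def)
      finally show ?thesis by (simp add: d_def card_Diff_singleton)
    qed
    ultimately show ?thesis by (simp add: det_mul R_def adjugate_mult_vec)
  qed
  then show ?thesis by (simp add: vec_eq_iff)
qed

text \<open>Turns the inverse, defined by choice, into a rational expression in the entries, from
  which smoothness of the raised tensor can be read off.\<close>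

lemma matrix_inv_eq_adjugate:
  fixes A :: "real ^ 'n ^ 'n"
  assumes "invertible A"
  shows "matrix_inv A = inverse (det A) *\<^sub>R adjugate A"
proof -
  have "adjugate A *v z = (det A *\<^sub>R matrix_inv A) *v z" for z
  proof -
    have "adjugate A *v (A *v (matrix_inv A *v z)) = det A *s (matrix_inv A *v z)"
      by (rule adjugate_mult_left)
    then show ?thesis
      by (simp add: matrix_vector_mul_assoc matrix_inv_both[OF assms]
          scaleR_matrix_vector_assoc[symmetric] scalar_mult_eq_scaleR)
  qed
  then have "adjugate A = det A *\<^sub>R matrix_inv A" by (simp add: matrix_eq)
  then show ?thesis using assms by (simp add: invertible_det_nz)
qed


section \<open>A characterization of the tensor with raised indices\<close>

context
  fixes F :: "real ^ 'n \<Rightarrow> real" and x :: "real ^ 'n"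
  assumes sym: "transpose (hess F x) = hess F x" and U0: "UF F x \<noteq> 0"
begin

lemma Pi_up_mult:
  "Pi_up F x *v z = matrix_inv (m_low (\<lambda>_. 1) F x) *v z
     - (inverse (UF F x) * (Nvec F x \<bullet> z)) *\<^sub>R Nvec F x"
  by (simp add: vec_eq_iff Pi_up_def Pi_up_of_def matrix_vector_mult_def inner_vec_def
      sum_subtractf sum_distrib_left sum_distrib_right algebra_simps)

lemma matrix_inv_m_low_mult: "matrix_inv (m_low (\<lambda>_. 1) F x) *v (m_low (\<lambda>_. 1) F x *v w) = w"
  using matrix_inv_both(2)[OF m_low_invertible[OF sym U0, of "\<lambda>_. 1"]]
  by (simp add: matrix_vector_mul_assoc)

text \<open>With q = 1, m sends N to dF, so its inverse returns N; since dF(N) = U(F), the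
  subtracted term is N too.\<close>

lemma Pi_up_grad: "Pi_up F x *v grad F x = 0"
proof -
  have "matrix_inv (m_low (\<lambda>_. 1) F x) *v grad F x = Nvec F x"
    using matrix_inv_m_low_mult[of "Nvec F x"] by (simp add: m_low_Nvec[OF sym U0])
  then show ?thesis using U0 by (simp add: Pi_up_mult UF_eq inner_commute)
qed

lemma Pi_up_m_low:
  "Pi_up F x *v (m_low (\<lambda>_. 1) F x *v w) = w - (inverse (UF F x) * (grad F x \<bullet> w)) *\<^sub>R Nvec F x"
proof -
  have "Nvec F x \<bullet> (m_low (\<lambda>_. 1) F x *v w) = (m_low (\<lambda>_. 1) F x *v Nvec F x) \<bullet> w"
    by (metis dot_lmul_matrix m_low_sym[OF sym U0] transpose_matrix_vector)
  then show ?thesis by (simp add: Pi_up_mult matrix_inv_m_low_mult m_low_Nvec[OF sym U0])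
qed

text \<open>m and the Hessian differ by a term with values in the span of dF, which the tensor
  annihilates.\<close>

lemma Pi_up_hess:
  "Pi_up F x *v (hess F x *v w) = w - (inverse (UF F x) * (grad F x \<bullet> w)) *\<^sub>R Nvec F x"
  using Pi_up_m_low[of w]
  by (simp add: m_low_mult matrix_vector_right_distrib matrix_vector_mult_scaleR Pi_up_grad)

text \<open>Every vector is m w for some w, hence a Hessian value plus a multiple of dF, and the two
  rules determine P there. Transformation laws can thus be checked without inverting the transformed
  m.\<close>

lemma Pi_up_eqI:
  assumes "P *v grad F x = 0"
    and "\<And>w. P *v (hess F x *v w) = w - (inverse (UF F x) * (grad F x \<bullet> w)) *\<^sub>R Nvec F x"
  shows "Pi_up F x = P"
proof -
  let ?M = "m_low (\<lambda>_. 1) F x"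
  have M: "P *v (?M *v w) = Pi_up F x *v (?M *v w)" for w
    unfolding Pi_up_m_low unfolding m_low_mult
    by (simp add: assms matrix_vector_right_distrib matrix_vector_mult_scaleR)
  have "?M *v (matrix_inv ?M *v z) = z" for z
    using matrix_inv_both(1)[OF m_low_invertible[OF sym U0, of "\<lambda>_. 1"]]
    by (simp add: matrix_vector_mul_assoc)
  then have "Pi_up F x *v z = P *v z" for z using M by metis
  then show ?thesis by (simp add: matrix_eq)
qed

text \<open>The values are images of the projection onto the kernel of dF along N.\<close>

lemma grad_inner_Pi_up: "grad F x \<bullet> (Pi_up F x *v z) = 0"
proof -
  define w where "w = matrix_inv (m_low (\<lambda>_. 1) F x) *v z"
  have "m_low (\<lambda>_. 1) F x *v w = z"
    using matrix_inv_both(1)[OF m_low_invertible[OF sym U0, of "\<lambda>_. 1"]]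
    by (simp add: w_def matrix_vector_mul_assoc)
  then have "Pi_up F x *v z = w - (inverse (UF F x) * (grad F x \<bullet> w)) *\<^sub>R Nvec F x"
    using Pi_up_m_low[of w] by simp
  then show ?thesis using U0 by (simp add: inner_diff_right UF_eq[symmetric])
qed

end

section \<open>Partial derivatives\<close>

lemma frechet_derivative_eq_grad:
  assumes "F differentiable (at x)"
  shows "frechet_derivative F (at x) v = grad F x \<bullet> v"
proof -
  let ?D = "frechet_derivative F (at x)"
  have l: "linear ?D" by (rule linear_frechet_derivative[OF assms])
  have "?D v = ?D (\<Sum>i\<in>UNIV. (v $ i) *\<^sub>R axis i 1)"
    using basis_expansion[of v] by (simp add: scalar_mult_eq_scaleR)
  also have "\<dots> = (\<Sum>i\<in>UNIV. v $ i * ?D (axis i 1))"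
    by (simp add: linear_sum[OF l] linear_scale[OF l])
  finally show ?thesis by (simp add: inner_vec_def grad_def pd_def mult.commute)
qed

lemma has_derivative_grad:
  "F differentiable (at x) \<Longrightarrow> (F has_derivative (\<lambda>v. grad F x \<bullet> v)) (at x)"
  using frechet_derivative_has_derivative[of F x]
  by (simp add: frechet_derivative_eq_grad[THEN ext])

lemma pd_eqI:
  assumes "(F has_derivative D) (at x)"
  shows "pd i F x = D (axis i 1)"
  by (simp add: pd_def frechet_derivative_eqI[OF assms])

lemma pd_cong_open:
  assumes "open S" "x \<in> S" "\<And>y. y \<in> S \<Longrightarrow> F y = G y"
  shows "pd i F x = pd i G x"
  unfolding pd_def by (rule fun_cong[OF frechet_derivative_cong_open[OF assms(1,2)]]) (rule assms(3))

lemma pd_compose: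
  assumes "F differentiable (at x)" "(\<phi> has_real_derivative d) (at (F x))"
  shows "pd i (\<lambda>y. \<phi> (F y)) x = d * pd i F x"
proof -
  have "((\<lambda>y. \<phi> (F y)) has_derivative (\<lambda>v. d * (grad F x \<bullet> v))) (at x)"
    using has_derivative_compose[OF has_derivative_grad[OF assms(1)]
        assms(2)[unfolded has_field_derivative_def]] .
  from pd_eqI[OF this] show ?thesis by (simp add: inner_axis grad_def)
qed

lemma pd_mult:
  assumes "F differentiable (at x)" "G differentiable (at x)"
  shows "pd i (\<lambda>y. F y * G y) x = F x * pd i G x + pd i F x * G x"
  using pd_eqI[OF has_derivative_mult[OF has_derivative_grad[OF assms(1)] has_derivative_grad[OF assms(2)]]]
  by (simp add: inner_axis grad_def)

lemma pd_cmult: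
  assumes "F differentiable (at x)"
  shows "pd i (\<lambda>y. c * F y) x = c * pd i F x"
  using pd_eqI[OF has_derivative_mult_right[OF has_derivative_grad[OF assms]]]
  by (simp add: inner_axis grad_def)

lemma pd_sum:
  assumes "\<And>k. k \<in> K \<Longrightarrow> F k differentiable (at x)"
  shows "pd i (\<lambda>y. \<Sum>k\<in>K. F k y) x = (\<Sum>k\<in>K. pd i (F k) x)"
  using pd_eqI[OF has_derivative_sum[OF has_derivative_grad[OF assms]]]
  by (simp add: inner_axis grad_def)

lemma has_derivative_affine:
  fixes X :: "real ^ 'n ^ 'm"
  shows "((\<lambda>y. X *v y + c) has_derivative (\<lambda>v. X *v v)) (at y)"
  using has_derivative_add[OF bounded_linear_imp_has_derivative[OF matrix_vector_mul_bounded_linear]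
      has_derivative_const, of X c] by simp

lemma grad_affine:
  fixes X :: "real ^ 'n ^ 'n"
  assumes "F differentiable (at (X *v y + c))"
  shows "grad (\<lambda>y. F (X *v y + c)) y = transpose X *v grad F (X *v y + c)"
proof -
  have d: "((\<lambda>y. F (X *v y + c)) has_derivative (\<lambda>v. grad F (X *v y + c) \<bullet> (X *v v))) (at y)"
    by (rule has_derivative_compose[OF has_derivative_affine has_derivative_grad[OF assms]])
  have "pd i (\<lambda>y. F (X *v y + c)) y = grad F (X *v y + c) \<bullet> column i X" for i
    unfolding pd_eqI[OF d] matrix_vector_mult_basis ..
  then show ?thesis
    unfolding vec_eq_iff grad_def[of "\<lambda>y. F (X *v y + c)"] vec_lambda_beta
    by (simp add: matrix_vector_mul_component inner_commute transpose_def column_def)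
qed

section \<open>Smoothness of the tensors and of both operators\<close>

context
  fixes S :: "(real ^ 'n) set" and F :: "real ^ 'n \<Rightarrow> real"
  assumes S: "open S" and F: "smooth_on S F"
begin

lemma smooth_on_pd: "smooth_on S (pd i F)"
  using smooth_on_frechet_derivative[OF F] by (simp add: pd_def[abs_def])

lemma smooth_on_grad: "smooth_on S (\<lambda>x. grad F x $ i)"
  using smooth_on_pd by (simp add: grad_def)

lemma hess_sym: "x \<in> S \<Longrightarrow> transpose (hess F x) = hess F x"
  using frechet_derivative_commute[OF S _ F]
  by (simp add: vec_eq_iff transpose_def hess_def pd_def[abs_def])

end

context
  fixes S :: "(real ^ 'n) set" and F :: "real ^ 'n \<Rightarrow> real"
  assumes S: "open S" and F: "smooth_on S F"
begin

lemma smooth_on_hess: "smooth_on S (\<lambda>x. hess F x $ i $ j)"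
  using smooth_on_pd[OF S smooth_on_pd[OF S F]] by (simp add: hess_def)

lemma smooth_on_Nvec: "smooth_on S (\<lambda>x. Nvec F x $ i)"
  unfolding Nvec_def Uadj_def vec_lambda_beta
  by (intro smooth_on_sum smooth_on_mult smooth_on_adjugate smooth_on_hess smooth_on_grad S F)

lemma smooth_on_UF: "smooth_on S (UF F)"
proof -
  have "smooth_on S (\<lambda>x. UF F x)"
    unfolding UF_def Uadj_def
    by (intro smooth_on_sum smooth_on_mult smooth_on_adjugate smooth_on_hess smooth_on_grad S F)
  then show ?thesis .
qed

context
  assumes U0: "\<And>x. x \<in> S \<Longrightarrow> UF F x \<noteq> 0"
begin

lemma mu_eq: "x \<in> S \<Longrightarrow> mu F x = (inverse (UF F x) / (real CARD('n) + 1)) *\<^sub>R grad (UF F) x"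
  using pd_compose[OF smooth_on_differentiable[OF smooth_on_UF] DERIV_ln_abs[OF U0]]
  by (simp add: vec_eq_iff mu_def grad_def)

lemma smooth_on_mu: "smooth_on S (\<lambda>x. mu F x $ i)"
proof (rule smooth_on_cong[OF S])
  show "inverse (UF F x) * inverse (real CARD('n) + 1) * grad (UF F) x $ i = mu F x $ i"
    if "x \<in> S" for x
    by (simp add: mu_eq[OF that] divide_inverse)
  show "smooth_on S (\<lambda>x. inverse (UF F x) * inverse (real CARD('n) + 1) * grad (UF F) x $ i)"
    by (intro smooth_on_mult smooth_on_inverse smooth_on_const smooth_on_grad smooth_on_UF S U0)
qed

lemma smooth_on_Pi_up: "smooth_on S (\<lambda>x. Pi_up F x $ i $ j)"
proof (rule smooth_on_cong[OF S])
  let ?M = "m_low (\<lambda>_. 1) F"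
  have M: "smooth_on S (\<lambda>x. ?M x $ k $ l)" for k l
    unfolding m_low_def Pi_low_def Hdet_def vec_lambda_beta
    by (intro smooth_on_add smooth_on_diff smooth_on_mult smooth_on_inverse smooth_on_const
        smooth_on_det smooth_on_grad smooth_on_UF smooth_on_hess S F U0)
  have det: "det (?M x) \<noteq> 0" if "x \<in> S" for x
    using m_low_invertible[OF hess_sym[OF S F that] U0[OF that], of "\<lambda>_. 1"]
    by (simp add: invertible_det_nz)
  \<comment> \<open>The explicit formula agrees with the tensor on S, where m is invertible, and is
    smooth there.\<close>
  show "inverse (det (?M x)) * adjugate (?M x) $ i $ j
      - inverse 1 * inverse (UF F x) * Nvec F x $ i * Nvec F x $ j = Pi_up F x $ i $ j"
    if "x \<in> S" for x
    using det[OF that] by (simp add: Pi_up_def Pi_up_of_def matrix_inv_eq_adjugate invertible_det_nz)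
  show "smooth_on S (\<lambda>x. inverse (det (?M x)) * adjugate (?M x) $ i $ j
      - inverse 1 * inverse (UF F x) * Nvec F x $ i * Nvec F x $ j)"
    by (intro smooth_on_diff smooth_on_mult smooth_on_inverse smooth_on_const smooth_on_det
        smooth_on_adjugate smooth_on_Nvec smooth_on_UF M det S U0)
qed

lemma smooth_on_W0: "smooth_on S (W0_op F)"
  unfolding W0_op_def
  by (rule smooth_on_vec[OF S], unfold vec_lambda_beta)
    (intro smooth_on_minus smooth_on_mult smooth_on_abs_powr smooth_on_inverse smooth_on_UF
      smooth_on_Nvec S U0)

lemma smooth_on_W: "smooth_on S (W_op F)"
  unfolding W_op_def k_up_def
  by (rule smooth_on_vec[OF S], unfold vec_lambda_beta)
    (intro smooth_on_diff smooth_on_sum smooth_on_minus smooth_on_mult smooth_on_abs_powr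
      smooth_on_inverse smooth_on_UF smooth_on_Nvec smooth_on_Pi_up smooth_on_mu S U0)

end

end

lemma W0_op_eq:
  fixes F :: "real ^ 'n \<Rightarrow> real"
  shows "W0_op F x = - ((\<bar>UF F x\<bar> powr (1 / (real CARD('n) + 1)) * inverse (UF F x)) *\<^sub>R Nvec F x)"
  by (simp add: W0_op_def vec_eq_iff)

text \<open>Separates the correction term, so that each property of W follows from that of
  \<open>W0_op\<close> and the behaviour of the raised tensor applied to \<open>mu\<close>.\<close>

lemma W_op_eq:
  fixes F :: "real ^ 'n \<Rightarrow> real"
  shows "W_op F x = W0_op F x - \<bar>UF F x\<bar> powr (1 / (real CARD('n) + 1)) *\<^sub>R (Pi_up F x *v mu F x)"
  by (simp add: W0_op_def W_op_def k_up_def vec_eq_iff matrix_vector_mult_def sum_distrib_left mult.assoc)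

section \<open>Dependence on the germ of the function\<close>

context
  fixes S :: "(real ^ 'n) set" and F G :: "real ^ 'n \<Rightarrow> real"
  assumes S: "open S" and FG: "\<And>x. x \<in> S \<Longrightarrow> F x = G x"
begin

lemma pd_local: "x \<in> S \<Longrightarrow> pd i F x = pd i G x"
  by (rule pd_cong_open[OF S _ FG])

lemma grad_local: "x \<in> S \<Longrightarrow> grad F x = grad G x"
  by (simp add: grad_def pd_local)

text \<open>Equality of the first partial derivatives is needed on the whole open set, since they
  are differentiated again.\<close>

lemma hess_local: "x \<in> S \<Longrightarrow> hess F x = hess G x"
  using pd_cong_open[OF S, of x "pd i F" "pd i G" for i] pd_local by (simp add: hess_def vec_eq_iff)

lemma UF_local: "x \<in> S \<Longrightarrow> UF F x = UF G x"
  by (simp add: UF_def Uadj_def grad_local hess_local)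

lemma Nvec_local: "x \<in> S \<Longrightarrow> Nvec F x = Nvec G x"
  by (simp add: Nvec_def Uadj_def grad_local hess_local)

lemma mu_local: "x \<in> S \<Longrightarrow> mu F x = mu G x"
  using pd_cong_open[OF S, of x "\<lambda>y. ln \<bar>UF F y\<bar>" "\<lambda>y. ln \<bar>UF G y\<bar>"] UF_local
  by (simp add: mu_def vec_eq_iff)

lemma Pi_up_local: "x \<in> S \<Longrightarrow> Pi_up F x = Pi_up G x"
  by (simp add: Pi_up_def Pi_up_of_def m_low_def Pi_low_def Hdet_def
      grad_local hess_local UF_local Nvec_local)

lemma W0_op_local: "x \<in> S \<Longrightarrow> W0_op F x = W0_op G x"
  by (simp add: W0_op_eq UF_local Nvec_local)

lemma W_op_local: "x \<in> S \<Longrightarrow> W_op F x = W_op G x"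
  by (simp add: W_op_eq W0_op_local UF_local mu_local Pi_up_local)

end

section \<open>Both operators yield transverse vector fields\<close>

lemma vector_field_operators:
  fixes \<Omega> :: "(real ^ 'n) set"
  assumes "open \<Omega>"
  shows "vector_field_operator \<Omega> W0_op" "vector_field_operator \<Omega> W_op"
proof -
  have "W0_op F x = W0_op G x \<and> W_op F x = W_op G x"
    if "\<forall>x\<in>\<Omega>. F x = G x" "x \<in> \<Omega>" for F G x
    using W0_op_local[OF assms, of F G x] W_op_local[OF assms, of F G x] that by blast
  moreover have "smooth_on \<Omega> (W0_op F)" "smooth_on \<Omega> (W_op F)" if "F \<in> Uclass \<Omega>" for F
    using that smooth_on_W0[OF assms, of F] smooth_on_W[OF assms, of F] by (auto simp: Uclass_def)
  ultimately show "vector_field_operator \<Omega> W0_op" "vector_field_operator \<Omega> W_op"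
    unfolding vector_field_operator_def by blast+
qed

lemma transverse_operators:
  fixes \<Omega> :: "(real ^ 'n) set"
  assumes \<Omega>: "open \<Omega>"
  shows "transverse \<Omega> W0_op" "transverse \<Omega> W_op"
proof -
  have "frechet_derivative F (at x) (W0_op F x) \<noteq> 0 \<and> frechet_derivative F (at x) (W_op F x) \<noteq> 0"
    if "F \<in> Uclass \<Omega>" "x \<in> \<Omega>" for F x
  proof -
    from that have F: "smooth_on \<Omega> F" and U: "UF F x \<noteq> 0" by (auto simp: Uclass_def)
    \<comment> \<open>As dF(N) = U(F), this pairing is minus the power of |U(F)|.\<close>
    have "grad F x \<bullet> W0_op F x \<noteq> 0"
      using U by (simp add: W0_op_eq UF_eq[symmetric])
    then show ?thesis
      by (simp add: frechet_derivative_eq_grad[OF smooth_on_differentiable[OF F that(2)]] W_op_eq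
          inner_diff_right grad_inner_Pi_up[OF hess_sym[OF \<Omega> F that(2)] U])
  qed
  then show "transverse \<Omega> W0_op" "transverse \<Omega> W_op"
    by (auto simp: transverse_def)
qed

section \<open>External reparameterizations\<close>

context
  fixes S :: "(real ^ 'n) set" and F :: "real ^ 'n \<Rightarrow> real" and \<psi> \<psi>' \<psi>'' :: "real \<Rightarrow> real"
  assumes S: "open S" and F: "smooth_on S F" and U0: "\<And>x. x \<in> S \<Longrightarrow> UF F x \<noteq> 0"
    and \<psi>: "\<And>x. x \<in> S \<Longrightarrow> (\<psi> has_real_derivative \<psi>' (F x)) (at (F x))"
    and \<psi>': "\<And>x. x \<in> S \<Longrightarrow> (\<psi>' has_real_derivative \<psi>'' (F x)) (at (F x))"
    and nz: "\<And>x. x \<in> S \<Longrightarrow> \<psi>' (F x) \<noteq> 0"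
begin

private abbreviation (input) "G \<equiv> \<lambda>x. \<psi> (F x)"

lemma differentiable_\<psi>'_F: "x \<in> S \<Longrightarrow> (\<lambda>y. \<psi>' (F y)) differentiable (at x)"
  using has_derivative_compose[OF has_derivative_grad[OF smooth_on_differentiable[OF F]]
      \<psi>'[unfolded has_field_derivative_def]]
  by (auto intro: differentiableI)

lemma grad_reparam: "x \<in> S \<Longrightarrow> grad G x = \<psi>' (F x) *\<^sub>R grad F x"
  using pd_compose[OF smooth_on_differentiable[OF F] \<psi>] by (simp add: vec_eq_iff grad_def)

lemma hess_reparam:
  assumes x: "x \<in> S"
  shows "hess G x $ i $ j
      = \<psi>' (F x) * hess F x $ i $ j + \<psi>'' (F x) * grad F x $ i * grad F x $ j"
proof -
  have "pd j (pd i G) x = pd j (\<lambda>y. \<psi>' (F y) * pd i F y) x"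
    by (rule pd_cong_open[OF S x]) (simp add: pd_compose[OF smooth_on_differentiable[OF F] \<psi>])
  also have "\<dots> = \<psi>' (F x) * pd j (pd i F) x + pd j (\<lambda>y. \<psi>' (F y)) x * pd i F x"
    by (rule pd_mult[OF differentiable_\<psi>'_F[OF x] smooth_on_differentiable[OF smooth_on_pd[OF S F] x]])
  also have "pd j (\<lambda>y. \<psi>' (F y)) x = \<psi>'' (F x) * pd j F x"
    by (rule pd_compose[OF smooth_on_differentiable[OF F x] \<psi>'[OF x]])
  finally show ?thesis by (simp add: hess_def grad_def mult_ac)
qed

text \<open>The second derivative of \<psi> enters the Hessian only through a rank one term along
  dF, invisible to \<open>adjugate_rank_one\<close>. The adjugate contributes n factors \<psi>' and
  the gradient one more, with \<open>CARD('n)\<close> = n + 1.\<close>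

lemma Nvec_reparam:
  assumes x: "x \<in> S"
  shows "Nvec G x = \<psi>' (F x) ^ CARD('n) *\<^sub>R Nvec F x"
proof -
  have "\<psi>' (F x) * \<psi>' (F x) ^ (CARD('n) - 1) = \<psi>' (F x) ^ CARD('n)"
    by (simp add: power_eq_if)
  then show ?thesis
    by (simp add: Nvec_eq Uadj_def grad_reparam[OF x] matrix_vector_mult_scaleR
        adjugate_rank_one[OF hess_reparam[OF x]])
qed

lemma UF_reparam: "x \<in> S \<Longrightarrow> UF G x = \<psi>' (F x) ^ (CARD('n) + 1) * UF F x"
  by (simp add: UF_eq grad_reparam Nvec_reparam)

text \<open>The tensor kills the rank one part of the new Hessian. In the projection along N the
  powers of \<psi>' cancel: -(n + 2) from U, 1 from dF, n + 1 from N.\<close>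

lemma Pi_up_reparam:
  assumes x: "x \<in> S"
  shows "Pi_up G x = inverse (\<psi>' (F x)) *\<^sub>R Pi_up F x"
proof (rule Pi_up_eqI)
  note Hs = hess_sym[OF S F x]
  show "transpose (hess G x) = hess G x"
    using Hs by (simp add: vec_eq_iff transpose_def hess_reparam[OF x] mult_ac)
  show "UF G x \<noteq> 0" using U0[OF x] nz[OF x] by (simp add: UF_reparam[OF x])
  show "inverse (\<psi>' (F x)) *\<^sub>R Pi_up F x *v grad G x = 0"
    by (simp add: grad_reparam[OF x] matrix_vector_mult_scaleR Pi_up_grad[OF Hs U0[OF x]]
        scaleR_matrix_vector_assoc[symmetric])
  show "inverse (\<psi>' (F x)) *\<^sub>R Pi_up F x *v (hess G x *v w)
      = w - (inverse (UF G x) * (grad G x \<bullet> w)) *\<^sub>R Nvec G x" for w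
  proof -
    have "hess G x *v w = \<psi>' (F x) *\<^sub>R (hess F x *v w) + (\<psi>'' (F x) * (grad F x \<bullet> w)) *\<^sub>R grad F x"
      by (simp add: vec_eq_iff matrix_vector_mult_def inner_vec_def hess_reparam[OF x]
          sum.distrib sum_distrib_left algebra_simps)
    moreover have "inverse a * (inverse (a ^ CARD('n)) * (a * a ^ CARD('n))) = 1" if "a \<noteq> 0" for a :: real
      using that by (simp add: field_simps)
    ultimately show ?thesis
      using nz[OF x]
      by (simp add: matrix_vector_right_distrib matrix_vector_mult_scaleR
          Pi_up_grad[OF Hs U0[OF x]] Pi_up_hess[OF Hs U0[OF x]] UF_reparam[OF x]
          grad_reparam[OF x] Nvec_reparam[OF x] scaleR_matrix_vector_assoc[symmetric])
  qed
qed

text \<open>U(F) acquires the factor \<psi>'(F)^(n + 2), whose logarithmic derivative is n + 2 times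
  that of \<psi>'(F); the normalization of \<open>mu\<close> cancels n + 2.\<close>

lemma mu_reparam:
  assumes x: "x \<in> S"
  shows "mu G x = mu F x + (\<psi>'' (F x) / \<psi>' (F x)) *\<^sub>R grad F x"
proof -
  let ?a = "\<lambda>y. \<psi>' (F y)" and ?m = "CARD('n) + 1"
  have U: "UF F differentiable (at x)"
    by (rule smooth_on_differentiable[OF smooth_on_UF[OF S F] x])
  have P: "((\<lambda>t. \<psi>' t ^ ?m) has_real_derivative real ?m * \<psi>' (F x) ^ CARD('n) * \<psi>'' (F x)) (at (F x))"
    using DERIV_power[OF \<psi>'[OF x], of ?m] by (simp add: mult_ac)
  have dP: "(\<lambda>y. ?a y ^ ?m) differentiable (at x)"
    using has_derivative_compose[OF has_derivative_grad[OF smooth_on_differentiable[OF F x]]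
        P[unfolded has_field_derivative_def]]
    by (rule differentiableI)
  have "pd p (\<lambda>y. ln \<bar>UF G y\<bar>) x
      = inverse (UF F x) * pd p (UF F) x + real ?m * (\<psi>'' (F x) / ?a x) * pd p F x" for p
  proof -
    have "pd p (\<lambda>y. ln \<bar>UF G y\<bar>) x = pd p (\<lambda>y. ln \<bar>?a y ^ ?m * UF F y\<bar>) x"
      by (rule pd_cong_open[OF S x]) (simp add: UF_reparam)
    also have "\<dots> = inverse (?a x ^ ?m * UF F x) * pd p (\<lambda>y. ?a y ^ ?m * UF F y) x"
    proof (rule pd_compose)
      show "(\<lambda>y. ?a y ^ ?m * UF F y) differentiable (at x)"
        by (rule differentiable_mult[OF dP U])
      show "((\<lambda>z. ln \<bar>z\<bar>) has_real_derivative inverse (?a x ^ ?m * UF F x)) (at (?a x ^ ?m * UF F x))"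
        using U0[OF x] nz[OF x] by (intro DERIV_ln_abs) simp
    qed
    also have "pd p (\<lambda>y. ?a y ^ ?m * UF F y) x
        = ?a x ^ ?m * pd p (UF F) x + real ?m * ?a x ^ CARD('n) * \<psi>'' (F x) * pd p F x * UF F x"
      using pd_mult[OF dP U] pd_compose[OF smooth_on_differentiable[OF F x] P] by simp
    also have "inverse (?a x ^ ?m * UF F x) * (?a x ^ ?m * pd p (UF F) x
          + real ?m * ?a x ^ CARD('n) * \<psi>'' (F x) * pd p F x * UF F x)
        = inverse (UF F x) * pd p (UF F) x + real ?m * (\<psi>'' (F x) / ?a x) * pd p F x"
    proof -
      \<comment> \<open>Here a is \<psi>'(F), A its power n + 1, u is U(F), k is n + 2 and b is
        \<psi>''(F); P and q are the partial derivatives of U(F) and F.\<close>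
      have "inverse (a * A * u) * (a * A * P + k * A * b * q * u) = inverse u * P + k * (b / a) * q"
        if "a \<noteq> 0" "A \<noteq> 0" "u \<noteq> 0" for a A u P k b q :: real
        using that by (simp add: field_simps)
      from this[OF nz[OF x] _ U0[OF x]] nz[OF x] show ?thesis
        unfolding Suc_eq_plus1[symmetric] power_Suc by simp
    qed
    finally show ?thesis .
  qed
  moreover have "1 / k * (u * P + k * c * q) = u / k * P + c * q" if "k \<noteq> 0" for k u P c q :: real
    using that by (simp add: field_simps)
  from this[of "real CARD('n) + 1"]
  have "1 / (real CARD('n) + 1) * (u * P + real ?m * c * q) = u / (real CARD('n) + 1) * P + c * q"
    for u P c q :: real
    by (simp add: add.commute)
  moreover have "mu F x = (inverse (UF F x) / (real CARD('n) + 1)) *\<^sub>R grad (UF F) x"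
    by (rule mu_eq[OF S F _ x]) (rule U0)
  ultimately show ?thesis
    unfolding vec_eq_iff mu_def[of G] grad_def vec_lambda_beta
      vector_add_component vector_scaleR_component real_scaleR_def
    by (simp only: vector_scaleR_component real_scaleR_def grad_def vec_lambda_beta) simp
qed

lemma abs_UF_reparam_powr:
  assumes x: "x \<in> S"
  shows "\<bar>UF G x\<bar> powr (1 / (real CARD('n) + 1))
      = \<bar>\<psi>' (F x)\<bar> * \<bar>UF F x\<bar> powr (1 / (real CARD('n) + 1))"
proof -
  have "(\<bar>\<psi>' (F x)\<bar> ^ (CARD('n) + 1)) powr (1 / (real CARD('n) + 1))
      = (\<bar>\<psi>' (F x)\<bar> powr real (CARD('n) + 1)) powr (1 / (real CARD('n) + 1))"
    using nz[OF x] by (subst powr_realpow) simp_all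
  also have "\<dots> = \<bar>\<psi>' (F x)\<bar>"
    unfolding powr_powr by (simp add: add.commute)
  finally show ?thesis
    by (simp add: UF_reparam[OF x] abs_mult powr_mult power_abs)
qed

lemma W0_op_reparam:
  assumes x: "x \<in> S"
  shows "W0_op G x = sgn (\<psi>' (F x)) *\<^sub>R W0_op F x"
proof -
  \<comment> \<open>The powers -(n + 2) and n + 1 of a leave |a| / a, the source of the
    sign.\<close>
  have "(\<bar>a\<bar> * t * inverse (a ^ (CARD('n) + 1) * u)) * a ^ CARD('n) = sgn a * (t * inverse u)"
    if "a \<noteq> 0" for a t u :: real
    using that by (simp add: sgn_real_def field_simps)
  from this[OF nz[OF x]] show ?thesis
    unfolding W0_op_eq abs_UF_reparam_powr[OF x]
    unfolding UF_reparam[OF x] Nvec_reparam[OF x]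
    by (simp only: scaleR_minus_right scaleR_scaleR)
qed

text \<open>The change of \<open>mu\<close> is a multiple of dF and is annihilated; the factor 1 /
  \<psi>' of the tensor and |\<psi>'| of the weight combine to the same sign.\<close>

lemma W_op_reparam:
  assumes x: "x \<in> S"
  shows "W_op G x = sgn (\<psi>' (F x)) *\<^sub>R W_op F x"
proof -
  have "Pi_up G x *v mu G x = inverse (\<psi>' (F x)) *\<^sub>R (Pi_up F x *v mu F x)"
    by (simp add: Pi_up_reparam[OF x] mu_reparam[OF x] matrix_vector_right_distrib
        matrix_vector_mult_scaleR Pi_up_grad[OF hess_sym[OF S F x] U0[OF x]]
        scaleR_matrix_vector_assoc[symmetric])
  moreover have "\<bar>\<psi>' (F x)\<bar> * inverse (\<psi>' (F x)) = sgn (\<psi>' (F x))"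
    using nz[OF x] by (simp add: sgn_real_def)
  ultimately show ?thesis
    by (simp add: W_op_eq W0_op_reparam[OF x] abs_UF_reparam_powr[OF x] scaleR_diff_right
        mult.commute mult.left_commute)
qed

end

section \<open>Diffeomorphisms of open sets of reals\<close>

lemma smooth_on_has_real_derivative:
  assumes "smooth_on I \<psi>" "y \<in> I"
  shows "(\<psi> has_real_derivative deriv \<psi> y) (at y)"
  using smooth_on_differentiable[OF assms] by (simp add: DERIV_deriv_iff_real_differentiable)

lemma smooth_on_deriv:
  fixes \<psi> :: "real \<Rightarrow> real"
  assumes "open I" "smooth_on I \<psi>"
  shows "smooth_on I (deriv \<psi>)"
proof (rule smooth_on_cong[OF assms(1) _ smooth_on_frechet_derivative[OF assms(2), of 1]])
  show "frechet_derivative \<psi> (at y) 1 = deriv \<psi> y" if "y \<in> I" for y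
    using frechet_derivative_eqI[OF
        smooth_on_has_real_derivative[OF assms(2) that, unfolded has_field_derivative_def]]
    by simp
qed

text \<open>If the derivative vanished, the chain rule for the smooth inverse after \<psi> would
  give the identity derivative 0.\<close>

lemma diffeo_onto_image_deriv_nonzero:
  assumes "open I" "diffeo_onto_image I \<psi>" "y \<in> I"
  shows "deriv \<psi> y \<noteq> 0"
proof
  assume 0: "deriv \<psi> y = 0"
  have s: "smooth_on I \<psi>" "inj_on \<psi> I" "smooth_on (\<psi> ` I) (inv_into I \<psi>)"
    using assms(2) by (auto simp: diffeo_onto_image_def)
  have d: "(\<psi> has_real_derivative 0) (at y)"
    using smooth_on_has_real_derivative[OF s(1) assms(3)] 0 by simp
  have "((\<lambda>t. inv_into I \<psi> (\<psi> t)) has_real_derivative deriv (inv_into I \<psi>) (\<psi> y) * 0) (at y)"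
    using smooth_on_has_real_derivative[OF s(3)] assms(3) by (intro DERIV_chain2[OF _ d]) auto
  then have "((\<lambda>t. t) has_real_derivative deriv (inv_into I \<psi>) (\<psi> y) * 0) (at y)"
    by (rule has_field_derivative_transform_within_open[OF _ assms(1,3)]) (simp add: s(2))
  then show False using DERIV_unique[OF DERIV_ident] by fastforce
qed

lemma external_reparam_invariant_operators:
  fixes \<Omega> :: "(real ^ 'n) set"
  assumes \<Omega>: "open \<Omega>"
  shows "external_reparam_invariant \<Omega> W0_op" "external_reparam_invariant \<Omega> W_op"
proof -
  have "W0_op (\<psi> \<circ> F) x = sgn (deriv \<psi> (F x)) *\<^sub>R W0_op F x
      \<and> W_op (\<psi> \<circ> F) x = sgn (deriv \<psi> (F x)) *\<^sub>R W_op F x"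
    if "F \<in> Uclass \<Omega>" and I: "open I" and \<psi>: "diffeo_onto_image I \<psi>" and x: "x \<in> \<Omega> \<inter> F -` I"
    for F I \<psi> x
  proof -
    \<comment> \<open>\<psi> is controlled only on I, so the argument is confined to the points that
      F sends into I, an open set by continuity.\<close>
    let ?S = "\<Omega> \<inter> F -` I"
    from that have F: "smooth_on \<Omega> F" and U: "\<And>x. x \<in> \<Omega> \<Longrightarrow> UF F x \<noteq> 0"
      by (auto simp: Uclass_def)
    have S: "open ?S"
      using smooth_on_continuous[OF F] \<Omega> I by (simp add: continuous_open_preimage)
    have FS: "smooth_on ?S F" using F by (rule smooth_on_subset) simp
    have s: "smooth_on I \<psi>" using \<psi> by (simp add: diffeo_onto_image_def)
    have d: "(\<psi> has_real_derivative deriv \<psi> (F y)) (at (F y))"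
        "(deriv \<psi> has_real_derivative deriv (deriv \<psi>) (F y)) (at (F y))"
        "deriv \<psi> (F y) \<noteq> 0" if "y \<in> ?S" for y
      using that smooth_on_has_real_derivative[OF s]
        smooth_on_has_real_derivative[OF smooth_on_deriv[OF I s]]
        diffeo_onto_image_deriv_nonzero[OF I \<psi>] by auto
    have US: "UF F y \<noteq> 0" if "y \<in> ?S" for y using U that by simp
    show ?thesis
      using W0_op_reparam[OF S FS US d x] W_op_reparam[OF S FS US d x] by (simp add: comp_def)
  qed
  then show "external_reparam_invariant \<Omega> W0_op" "external_reparam_invariant \<Omega> W_op"
    unfolding external_reparam_invariant_def by blast+
qed

section \<open>Affine transformations\<close>

context
  fixes S :: "(real ^ 'n) set" and F :: "real ^ 'n \<Rightarrow> real"
    and X L :: "real ^ 'n ^ 'n" and c :: "real ^ 'n"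
  assumes S: "open S" and F: "smooth_on S F" and U0: "\<And>x. x \<in> S \<Longrightarrow> UF F x \<noteq> 0"
    and LX: "L ** X = mat 1"
begin

private abbreviation (input) "h \<equiv> \<lambda>y. X *v y + c"
private abbreviation (input) "Fh \<equiv> \<lambda>y. F (h y)"

lemma open_affine_preimage: "open (h -` S)"
  by (intro open_vimage S continuous_intros matrix_vector_mult_linear_continuous_on)

text \<open>Products with a transposed matrix keep their form, so that the transposes of L and X can
  cancel by \<open>transpose_LX_mult\<close>.\<close>

declare transpose_matrix_vector [simp del]

lemma XL: "X ** L = mat 1"
  using LX matrix_left_right_inverse by blast

lemma LX_mult: "L *v (X *v w) = w"
  by (simp add: matrix_vector_mul_assoc LX)

lemma XL_mult: "X *v (L *v w) = w"
  by (simp add: matrix_vector_mul_assoc XL)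

lemma transpose_LX_mult: "transpose L *v (transpose X *v w) = w"
  by (simp add: matrix_vector_mul_assoc matrix_transpose_mul[symmetric] XL)

lemma det_X_nonzero: "det X \<noteq> 0" and det_LX: "det L * det X = 1"
  using arg_cong[OF LX, of det] by (auto simp: det_mul)

lemma grad_Fh: "h y \<in> S \<Longrightarrow> grad Fh y = transpose X *v grad F (h y)"
  by (rule grad_affine[OF smooth_on_differentiable[OF F]])

lemma hess_Fh:
  assumes y: "h y \<in> S"
  shows "hess Fh y = transpose X ** hess F (h y) ** X"
proof -
  have "hess Fh y $ i $ j = (transpose X ** hess F (h y) ** X) $ i $ j" for i j
  proof -
    let ?P = "\<lambda>y. \<Sum>k\<in>UNIV. X $ k $ i * pd k F (h y)"
    have dp: "pd k F differentiable (at (h y))" for k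
      by (rule smooth_on_differentiable[OF smooth_on_pd[OF S F] y])
    have d: "(\<lambda>y. pd k F (h y)) differentiable (at y)" for k
      using has_derivative_compose[OF has_derivative_affine has_derivative_grad[OF dp]]
      by (rule differentiableI)
    have "pd j (pd i Fh) y = pd j ?P y"
    \<comment> \<open>The formula for the first derivatives holds on an entire open preimage and may
      therefore be differentiated once more.\<close>
    proof (rule pd_cong_open[OF open_affine_preimage])
      show "pd i Fh z = ?P z" if "z \<in> h -` S" for z
        using arg_cong[OF grad_Fh, of z "\<lambda>v. v $ i"] that
        by (simp add: grad_def matrix_vector_mult_def transpose_def)
    qed (use y in simp)
    also have "\<dots> = (\<Sum>k\<in>UNIV. pd j (\<lambda>y. X $ k $ i * pd k F (h y)) y)"
      by (intro pd_sum differentiable_mult differentiable_const d)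
    also have "\<dots> = (\<Sum>k\<in>UNIV. X $ k $ i * pd j (\<lambda>y. pd k F (h y)) y)"
      by (simp add: pd_cmult[OF d])
    also have "\<dots> = (\<Sum>k\<in>UNIV. X $ k $ i * (\<Sum>l\<in>UNIV. X $ l $ j * pd l (pd k F) (h y)))"
      using arg_cong[OF grad_affine[OF dp], of "\<lambda>v. v $ j"]
      by (simp add: grad_def matrix_vector_mult_def transpose_def)
    also have "\<dots> = (transpose X ** (hess F (h y) ** X)) $ i $ j"
      by (simp add: matrix_matrix_mult_def transpose_def hess_def mult.commute)
    finally show ?thesis by (simp add: hess_def matrix_mul_assoc)
  qed
  then show ?thesis by (simp add: vec_eq_iff)
qed

text \<open>X and its transpose are peeled off the adjugate of the congruent Hessian one at a time,
  each at the price of a factor \<open>det X\<close>; L then undoes X.\<close>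

lemma Nvec_Fh:
  assumes y: "h y \<in> S"
  shows "Nvec Fh y = (det X)\<^sup>2 *\<^sub>R (L *v Nvec F (h y))"
proof -
  let ?f = "grad F (h y)" and ?H = "hess F (h y)"
  have "X *v Nvec Fh y = (X ** adjugate (transpose X ** ?H ** X)) *v (transpose X *v ?f)"
    by (simp add: Nvec_eq Uadj_def grad_Fh[OF y] hess_Fh[OF y] matrix_vector_mul_assoc matrix_mul_assoc)
  also have "\<dots> = det X *\<^sub>R (adjugate (transpose X ** ?H) *v (transpose X *v ?f))"
    by (simp add: adjugate_mult_factor_left scaleR_matrix_vector_assoc[symmetric])
  also have "adjugate (transpose X ** ?H) *v (transpose X *v ?f) = det X *\<^sub>R Nvec F (h y)"
    by (simp add: matrix_vector_mul_assoc adjugate_mult_factor_right Nvec_eq Uadj_def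
        scaleR_matrix_vector_assoc[symmetric])
  also have "det X *\<^sub>R det X *\<^sub>R Nvec F (h y) = (det X)\<^sup>2 *\<^sub>R Nvec F (h y)"
    by (simp add: power2_eq_square)
  finally have "L *v (X *v Nvec Fh y) = L *v ((det X)\<^sup>2 *\<^sub>R Nvec F (h y))" by simp
  then show ?thesis by (simp add: LX_mult matrix_vector_mult_scaleR)
qed

lemma transpose_X_inner: "(transpose X *v v) \<bullet> w = v \<bullet> (X *v w)"
  by (metis dot_lmul_matrix transpose_matrix_vector)

lemma UF_Fh: "h y \<in> S \<Longrightarrow> UF Fh y = (det X)\<^sup>2 * UF F (h y)"
  by (simp add: UF_eq Nvec_Fh grad_Fh transpose_X_inner XL_mult)

text \<open>Contravariance checked on the two rules: the transpose of L cancels that of X in both dF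
  and the Hessian, and the squared determinants of U and N cancel.\<close>

lemma Pi_up_Fh:
  assumes y: "h y \<in> S"
  shows "Pi_up Fh y = L ** Pi_up F (h y) ** transpose L"
proof (rule Pi_up_eqI)
  note Hs = hess_sym[OF S F y] and U = U0[OF y]
  show "transpose (hess Fh y) = hess Fh y"
    using Hs by (simp add: hess_Fh[OF y] matrix_transpose_mul matrix_mul_assoc)
  show "UF Fh y \<noteq> 0" using U det_X_nonzero by (simp add: UF_Fh[OF y])
  show "L ** Pi_up F (h y) ** transpose L *v grad Fh y = 0"
    by (simp add: grad_Fh[OF y] matrix_vector_mul_assoc[symmetric] transpose_LX_mult
        Pi_up_grad[OF Hs U])
  show "L ** Pi_up F (h y) ** transpose L *v (hess Fh y *v w)
      = w - (inverse (UF Fh y) * (grad Fh y \<bullet> w)) *\<^sub>R Nvec Fh y" for w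
    using det_X_nonzero
    by (simp add: hess_Fh[OF y] matrix_vector_mul_assoc[symmetric] transpose_LX_mult
        Pi_up_hess[OF Hs U] matrix_vector_mult_diff_distrib LX_mult matrix_vector_mult_scaleR
        UF_Fh[OF y] Nvec_Fh[OF y] grad_Fh[OF y] transpose_X_inner)
qed

text \<open>The constant factor of U(F) disappears in the logarithmic derivative, so
  \<open>mu\<close> pulls back as a covector.\<close>

lemma mu_Fh:
  assumes y: "h y \<in> S"
  shows "mu Fh y = transpose X *v mu F (h y)"
proof -
  have dU: "UF F differentiable (at z)" if "z \<in> S" for z
    by (rule smooth_on_differentiable[OF smooth_on_UF[OF S F] that])
  have d: "(\<lambda>y. UF F (h y)) differentiable (at y)"
    using has_derivative_compose[OF has_derivative_affine has_derivative_grad[OF dU[OF y]]]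
    by (rule differentiableI)
  have "pd p (\<lambda>y. ln \<bar>UF Fh y\<bar>) y
      = inverse (UF F (h y)) * (transpose X *v grad (UF F) (h y)) $ p" for p
  proof -
    have "pd p (\<lambda>y. ln \<bar>UF Fh y\<bar>) y = pd p (\<lambda>y. ln \<bar>(det X)\<^sup>2 * UF F (h y)\<bar>) y"
      by (rule pd_cong_open[OF open_affine_preimage]) (use y in \<open>simp_all add: UF_Fh\<close>)
    also have "\<dots> = inverse ((det X)\<^sup>2 * UF F (h y)) * pd p (\<lambda>y. (det X)\<^sup>2 * UF F (h y)) y"
    proof (rule pd_compose)
      show "(\<lambda>y. (det X)\<^sup>2 * UF F (h y)) differentiable (at y)"
        by (intro differentiable_mult differentiable_const d)
      show "((\<lambda>z. ln \<bar>z\<bar>) has_real_derivative inverse ((det X)\<^sup>2 * UF F (h y)))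
          (at ((det X)\<^sup>2 * UF F (h y)))"
        using U0[OF y] det_X_nonzero by (intro DERIV_ln_abs) simp
    qed
    also have "pd p (\<lambda>y. (det X)\<^sup>2 * UF F (h y)) y
        = (det X)\<^sup>2 * (transpose X *v grad (UF F) (h y)) $ p"
      using arg_cong[OF grad_affine[OF dU[OF y]], of "\<lambda>v. v $ p"]
      by (simp add: pd_cmult[OF d] grad_def)
    finally show ?thesis using det_X_nonzero by simp
  qed
  then show ?thesis
    by (simp add: vec_eq_iff mu_def[of Fh] mu_eq[OF S F U0 y] matrix_vector_mult_scaleR)
qed

lemma abs_UF_Fh_powr:
  assumes y: "h y \<in> S"
  shows "\<bar>UF Fh y\<bar> powr (1 / (real CARD('n) + 1))
    = \<bar>det X\<bar> powr (2 / (real CARD('n) + 1)) * \<bar>UF F (h y)\<bar> powr (1 / (real CARD('n) + 1))"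
proof -
  have "((det X)\<^sup>2) powr s = \<bar>det X\<bar> powr (2 * s)" for s
    using det_X_nonzero powr_realpow[of "\<bar>det X\<bar>" 2]
    by (simp add: powr_powr[symmetric])
  then show ?thesis by (simp add: UF_Fh[OF y] abs_mult powr_mult)
qed

text \<open>The squared determinants of N and of 1 / U(F) cancel; only the weight |U(F)|^(1 / (n +
  2)) contributes one.\<close>

lemma W0_op_Fh:
  assumes y: "h y \<in> S"
  shows "W0_op Fh y = \<bar>det X\<bar> powr (2 / (real CARD('n) + 1)) *\<^sub>R (L *v W0_op F (h y))"
proof -
  have "L *v W0_op F (h y)
      = - ((\<bar>UF F (h y)\<bar> powr (1 / (real CARD('n) + 1)) * inverse (UF F (h y))) *\<^sub>R (L *v Nvec F (h y)))"
    unfolding W0_op_eq scaleR_minus_left[symmetric] by (rule matrix_vector_mult_scaleR)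
  then show ?thesis
    using det_X_nonzero by (simp add: W0_op_eq[of Fh] UF_Fh[OF y] Nvec_Fh[OF y] abs_UF_Fh_powr[OF y, unfolded UF_Fh[OF y]])
qed

lemma W_op_Fh:
  assumes y: "h y \<in> S"
  shows "W_op Fh y = \<bar>det X\<bar> powr (2 / (real CARD('n) + 1)) *\<^sub>R (L *v W_op F (h y))"
proof -
  have "Pi_up Fh y *v mu Fh y = L *v (Pi_up F (h y) *v mu F (h y))"
    by (simp add: Pi_up_Fh[OF y] mu_Fh[OF y] matrix_vector_mul_assoc[symmetric] transpose_LX_mult)
  then show ?thesis
    by (simp add: W_op_eq W0_op_Fh[OF y] abs_UF_Fh_powr[OF y] matrix_vector_mult_diff_distrib
        matrix_vector_mult_scaleR scaleR_diff_right)
qed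

end

lemma equiaffinely_invariant_operators:
  fixes \<Omega> :: "(real ^ 'n) set"
  assumes \<Omega>: "open \<Omega>"
  shows "equiaffinely_invariant \<Omega> W0_op" "equiaffinely_invariant \<Omega> W_op"
proof -
  let ?s = "2 / (real CARD('n) + 1)"
  have "L *v W0_op F (inv g x) = \<bar>det L\<bar> powr ?s *\<^sub>R W0_op (F \<circ> inv g) x
      \<and> L *v W_op F (inv g x) = \<bar>det L\<bar> powr ?s *\<^sub>R W_op (F \<circ> inv g) x"
    if "F \<in> Uclass \<Omega>" and L: "invertible L" and g: "g = (\<lambda>x. L *v x + b)" and x: "inv g x \<in> \<Omega>"
    for F and L :: "real ^ 'n ^ 'n" and b g x
  proof -
    from that have F: "smooth_on \<Omega> F" and U: "\<And>x. x \<in> \<Omega> \<Longrightarrow> UF F x \<noteq> 0"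
      by (auto simp: Uclass_def)
    define X where "X = matrix_inv L"
    define c where "c = - (X *v b)"
    have LX: "L ** X = mat 1" and XL: "X ** L = mat 1"
      using matrix_inv_both[OF L] by (simp_all add: X_def)
    have inv: "inv g = (\<lambda>y. X *v y + c)"
    proof (rule inv_equality)
      show "X *v g y + c = y" for y
        by (simp add: g c_def matrix_vector_right_distrib matrix_vector_mul_assoc XL)
      show "g (X *v y + c) = y" for y
        unfolding g c_def using matrix_vector_mult_diff_distrib[of L "X *v y" "X *v b"]
        by (simp add: matrix_vector_mul_assoc LX)
    qed
    have y: "X *v x + c \<in> \<Omega>" using x by (simp add: inv)
    \<comment> \<open>Moves the weight from the inverse linear part X, where the transformation laws
      put it, to L.\<close>
    have "\<bar>det L\<bar> powr ?s * \<bar>det X\<bar> powr ?s = 1"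
      using det_LX[OF \<Omega> F U LX] by (simp add: powr_mult[symmetric] abs_mult[symmetric])
    then show ?thesis
      using W0_op_Fh[OF \<Omega> F U LX y] W_op_Fh[OF \<Omega> F U LX y] by (simp add: inv comp_def)
  qed
  then show "equiaffinely_invariant \<Omega> W0_op" "equiaffinely_invariant \<Omega> W_op"
    unfolding equiaffinely_invariant_def Let_def by blast+
qed

theorem theorem2p8:
  fixes \<Omega> :: "(real ^ 'n) set"
  assumes "open \<Omega>"
  shows "(vector_field_operator \<Omega> W_op \<and> transverse \<Omega> W_op \<and>
            external_reparam_invariant \<Omega> W_op \<and> equiaffinely_invariant \<Omega> W_op) \<and>
         (vector_field_operator \<Omega> W0_op \<and> transverse \<Omega> W0_op \<and>
            external_reparam_invariant \<Omega> W0_op \<and> equiaffinely_invariant \<Omega> W0_op)"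
  by (intro conjI vector_field_operators transverse_operators external_reparam_invariant_operators
      equiaffinely_invariant_operators assms)

end
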